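(* Let $Y$ be a compact set in $\mathbb{C}^N$ such that $\widehat{Y}\setminus Y\neq\emptyset$ and $P(Y)$ has dense invertibles. Then there exists a compact set $X$ in $\mathbb{C}^{N+1}$ such that, letting $\pi$ denote the restriction to $\widehat{X}$ of the projection $\mathbb{C}^{N+1}\to\mathbb{C}^N$ onto the first $N$ coordinates: (i) $\pi(X)=Y$; (ii) $\pi(\widehat{X}\setminus X)=\widehat{Y}\setminus Y$; (iii) $P(X)$ has dense invertibles; (iv) every point of $\widehat{X}$ is a one-point Gleason part for $P(X)$ and there are no nonzero bounded point derivations for $P(X)$; (v) for each $z\in\widehat{Y}$ the fiber $\pi^{-1}(z)$ is a Cantor set.
   Context: For compact $X\subset\mathbb{C}^N$, $\widehat{X}=\{z: |p(z)|\le\max_X|p| \text{ for all polynomials } p\}$ is the polynomial hull, which is naturally identified with the maximal ideal space of $P(X)$, the uniform closure on $X$ of the polynomials in the coordinate functions. A uniform algebra has dense invertibles if its invertible elements are dense in it. For a uniform algebra $A$, the Gleason parts are the equivalence classes of the maximal ideal space under $\varphi\sim\psi$ iff $\|\varphi-\psi\|<2$ in the dual norm of $A^*$. For a multiplicative linear functional $\phi$ on $A$, a point derivation at $\phi$ is a linear functional $\psi$ with $\psi(fg)=\psi(f)\phi(g)+\phi(f)\psi(g)$ for all $f,g\in A$; it is bounded if it is continuous. *)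

theory Defs
  imports "HOL-Analysis.Analysis"
begin

text \<open>Points of C^N are vectors complex^'n (N = CARD('n)); points of C^(N+1) are
 vectors complex^('n option), the extra coordinate being indexed by None.\<close>

inductive_set cpoly :: "(complex^'n \<Rightarrow> complex) set" where
  const: "(\<lambda>z. c) \<in> cpoly"
| coord: "(\<lambda>z. z $ i) \<in> cpoly"
| add: "p \<in> cpoly \<Longrightarrow> q \<in> cpoly \<Longrightarrow> (\<lambda>z. p z + q z) \<in> cpoly"
| mult: "p \<in> cpoly \<Longrightarrow> q \<in> cpoly \<Longrightarrow> (\<lambda>z. p z * q z) \<in> cpoly"

definition phull :: "(complex^'n) set \<Rightarrow> (complex^'n) set" where
  "phull X = {z. \<forall>p\<in>cpoly. norm (p z) \<le> (SUP x\<in>X. norm (p x))}"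

text \<open>P(X): uniform closure on X of the polynomials (elements are functions, considered on X).\<close>
definition PX :: "(complex^'n) set \<Rightarrow> (complex^'n \<Rightarrow> complex) set" where
  "PX X = {f. \<forall>e>0. \<exists>p\<in>cpoly. \<forall>x\<in>X. norm (f x - p x) < e}"

definition supn :: "(complex^'n) set \<Rightarrow> (complex^'n \<Rightarrow> complex) \<Rightarrow> real" where
  "supn X f = (SUP x\<in>X. norm (f x))"

definition dense_invertibles :: "(complex^'n) set \<Rightarrow> bool" where
  "dense_invertibles X \<longleftrightarrow>
     (\<forall>f\<in>PX X. \<forall>e>0. \<exists>g\<in>PX X. (\<exists>h\<in>PX X. \<forall>x\<in>X. g x * h x = 1)
                                 \<and> supn X (\<lambda>x. f x - g x) < e)"

text \<open>The multiplicative functional on P(X) corresponding to z in the polynomial hull: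
 the value at z of the unique continuous extension (limit of p z over polynomial approximants p).\<close>
definition hat :: "(complex^'n) set \<Rightarrow> (complex^'n \<Rightarrow> complex) \<Rightarrow> complex^'n \<Rightarrow> complex" where
  "hat X f z = (THE c. \<forall>e>0. \<exists>d>0. \<forall>p\<in>cpoly.
                  (\<forall>x\<in>X. norm (f x - p x) < d) \<longrightarrow> norm (p z - c) < e)"

definition gdist :: "(complex^'n) set \<Rightarrow> complex^'n \<Rightarrow> complex^'n \<Rightarrow> real" where
  "gdist X z w = (SUP f\<in>{f\<in>PX X. supn X f \<le> 1}. norm (hat X f z - hat X f w))"

definition one_point_part :: "(complex^'n) set \<Rightarrow> complex^'n \<Rightarrow> bool" where
  "one_point_part X z \<longleftrightarrow> (\<forall>w\<in>phull X. gdist X z w < 2 \<longrightarrow> w = z)"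

definition point_derivation ::
  "(complex^'n) set \<Rightarrow> complex^'n \<Rightarrow> ((complex^'n \<Rightarrow> complex) \<Rightarrow> complex) \<Rightarrow> bool" where
  "point_derivation X z \<psi> \<longleftrightarrow>
     (\<forall>f\<in>PX X. \<forall>g\<in>PX X. \<psi> (\<lambda>x. f x + g x) = \<psi> f + \<psi> g) \<and>
     (\<forall>c. \<forall>f\<in>PX X. \<psi> (\<lambda>x. c * f x) = c * \<psi> f) \<and>
     (\<forall>f\<in>PX X. \<forall>g\<in>PX X. \<psi> (\<lambda>x. f x * g x) = \<psi> f * hat X g z + hat X f z * \<psi> g)"

definition bounded_point_derivation ::
  "(complex^'n) set \<Rightarrow> complex^'n \<Rightarrow> ((complex^'n \<Rightarrow> complex) \<Rightarrow> complex) \<Rightarrow> bool" where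
  "bounded_point_derivation X z \<psi> \<longleftrightarrow>
     point_derivation X z \<psi> \<and> (\<exists>C. \<forall>f\<in>PX X. norm (\<psi> f) \<le> C * supn X f)"

definition proj :: "complex^('n option) \<Rightarrow> complex^'n" where
  "proj x = (\<chi> i. x $ Some i)"

definition cantor_ternary :: "real set" where
  "cantor_ternary = range (\<lambda>a::nat \<Rightarrow> bool. \<Sum>n. (if a n then 2 else 0) / 3 ^ Suc n)"

definition is_cantor_set :: "'a::topological_space set \<Rightarrow> bool" where
  "is_cantor_set S \<longleftrightarrow> S homeomorphic cantor_ternary"

end

theory Submission
  imports Defs
begin

text \<open>
  Over the hull \<open>K\<close> of \<open>Y\<close> one adjoins, one after another, square roots \<open>t\<^sub>0, t\<^sub>1, \<dots>\<close> of
  invertible elements \<open>F\<^sub>k(z, t\<^sub>0, \<dots>, t\<^bsub>k-1\<^esub>)\<close>, where the \<open>F\<^sub>k\<close> run through all invertible polynomials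
  with rational coefficients. Every step is a two-sheeted covering; it preserves density of invertibles
  and the maximum principle (use the trace and the norm of the quadratic extension), so in the limit the
  squares are dense as well. Dense squares force one-point Gleason parts and kill bounded point derivations.
  The infinitely many roots are encoded in a single coordinate \<open>w = \<Sum>k. \<epsilon>\<^sub>k t\<^sub>k\<close>: if \<open>\<epsilon>\<^sub>k\<close> decreases fast enough,
  each \<open>t\<^sub>k\<close> is recovered as a uniform limit of polynomials in \<open>(z, w)\<close>. Fibers are the boundaries of
  binary trees.
\<close>

subsection \<open>Uniform closures of function algebras\<close>

text \<open>All estimates are made over the whole hull of \<open>Y\<close>. The part over
  \<open>Y\<close> is singled out only at the end, and the maximum principle guarantees that its
  hull is the entire tower. Roots are taken of invertible elements only. The two values of a root
  then never collide, so each step doubles every fiber, and the root stays away from 0, which is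
  what later allows one coordinate to tell the signs apart. Density of invertibles is what makes
  these elements plentiful, so it has to survive every step. Since invertibility is an open
  condition, countably many polynomials suffice and one sequence of steps can treat them all. The
  obstacle is the single extra coordinate. From \<open>w\<close> and the earlier roots one can form
  only an approximation \<open>v\<close> of \<open>t_k\<close>. But \<open>t_k^2 = F_k\<close> is
  already available, so the ratio \<open>v / t_k\<close>, which is close to 1, is the principal root
  of \<open>v^2 / F_k\<close>; dividing \<open>v\<close> by it returns \<open>t_k\<close>
  exactly.\<close>

definition ucl :: "('a \<Rightarrow> complex) set \<Rightarrow> 'a set \<Rightarrow> ('a \<Rightarrow> complex) set" where
  "ucl P S = {f. \<forall>e>0. \<exists>p\<in>P. \<forall>x\<in>S. norm (f x - p x) < e}"

lemma PX_eq_ucl: "PX X = ucl cpoly X"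
  by (simp add: PX_def ucl_def)

lemma ucl_subset_gens: "P \<subseteq> ucl P S"
  by (force simp: ucl_def)

lemma uclD:
  assumes "f \<in> ucl P S" "e > 0"
  obtains p where "p \<in> P" "\<And>x. x \<in> S \<Longrightarrow> norm (f x - p x) < e"
  using assms unfolding ucl_def by blast

lemma ucl_cong:
  assumes "f \<in> ucl P S" "\<And>x. x \<in> S \<Longrightarrow> f x = g x"
  shows "g \<in> ucl P S"
  using assms unfolding ucl_def by fastforce

lemma ucl_closed:
  assumes "\<And>e. e > 0 \<Longrightarrow> \<exists>g\<in>ucl P S. \<forall>x\<in>S. norm (f x - g x) < e"
  shows "f \<in> ucl P S"
  unfolding ucl_def
proof safe
  fix e :: real assume "e > 0"
  then obtain g where g: "g \<in> ucl P S" "\<forall>x\<in>S. norm (f x - g x) < e/2"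
    using assms[of "e/2"] by auto
  obtain p where p: "p \<in> P" "\<And>x. x \<in> S \<Longrightarrow> norm (g x - p x) < e/2"
    using uclD[OF g(1)] \<open>e > 0\<close> by (metis half_gt_zero)
  have "norm (f x - p x) < e" if "x \<in> S" for x
    using g(2) p(2) that by (metis norm_diff_triangle_less field_sum_of_halves)
  with p(1) show "\<exists>p\<in>P. \<forall>x\<in>S. norm (f x - p x) < e" by blast
qed

text \<open>Changes the generators and shrinks the domain in one go; passages between stages, and
  between the tower and the encoded coordinates, rest on it.\<close>

lemma ucl_subset:
  assumes "P \<subseteq> ucl Q S" "S \<subseteq> T" "f \<in> ucl P T"
  shows "f \<in> ucl Q S"
proof (rule ucl_closed)
  fix e :: real assume "e > 0"
  then obtain p where "p \<in> P" "\<And>x. x \<in> T \<Longrightarrow> norm (f x - p x) < e"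
    using uclD[OF assms(3)] by blast
  then show "\<exists>g\<in>ucl Q S. \<forall>x\<in>S. norm (f x - g x) < e"
    using assms(1,2) by blast
qed

definition invertible_in :: "('a \<Rightarrow> complex) set \<Rightarrow> 'a set \<Rightarrow> ('a \<Rightarrow> complex) \<Rightarrow> bool" where
  "invertible_in P S g \<longleftrightarrow> g \<in> ucl P S \<and> (\<exists>h\<in>ucl P S. \<forall>x\<in>S. g x * h x = 1)"

text \<open>Boundedness is asked of the generators and not of \<open>S\<close>, since the sets at
  the finite stages of the tower are unbounded: their later coordinates are free.\<close>

locale fun_algebra =
  fixes P :: "('a \<Rightarrow> complex) set" and S :: "'a set"
  assumes const: "(\<lambda>x. c) \<in> P"
    and add: "p \<in> P \<Longrightarrow> q \<in> P \<Longrightarrow> (\<lambda>x. p x + q x) \<in> P"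
    and mult: "p \<in> P \<Longrightarrow> q \<in> P \<Longrightarrow> (\<lambda>x. p x * q x) \<in> P"
    and bounded_gen: "p \<in> P \<Longrightarrow> \<exists>C. \<forall>x\<in>S. norm (p x) \<le> C"
begin

lemma bounded_ucl:
  assumes "f \<in> ucl P S"
  obtains C where "C > 0" "\<And>x. x \<in> S \<Longrightarrow> norm (f x) \<le> C"
proof -
  obtain p where p: "p \<in> P" "\<And>x. x \<in> S \<Longrightarrow> norm (f x - p x) < 1"
    using uclD[OF assms, of 1] by auto
  obtain C where C: "\<forall>x\<in>S. norm (p x) \<le> C" using bounded_gen p(1) by blast
  have "norm (f x) \<le> \<bar>C\<bar> + 1" if "x \<in> S" for x
    using p(2)[OF that] C that norm_triangle_ineq[of "f x - p x" "p x"] by force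
  then show ?thesis using that[of "\<bar>C\<bar> + 1"] by simp
qed

lemma const_ucl: "(\<lambda>x. c) \<in> ucl P S"
  using subsetD[OF ucl_subset_gens const] .

lemma add_ucl:
  assumes "f \<in> ucl P S" "g \<in> ucl P S"
  shows "(\<lambda>x. f x + g x) \<in> ucl P S"
  unfolding ucl_def
proof safe
  fix e :: real assume e: "e > 0"
  obtain p where p: "p \<in> P" "\<And>x. x \<in> S \<Longrightarrow> norm (f x - p x) < e/2"
    using uclD[OF assms(1)] e by (metis half_gt_zero)
  obtain q where q: "q \<in> P" "\<And>x. x \<in> S \<Longrightarrow> norm (g x - q x) < e/2"
    using uclD[OF assms(2)] e by (metis half_gt_zero)
  have "norm (f x + g x - (p x + q x)) < e" if "x \<in> S" for x
    using p(2)[OF that] q(2)[OF that] norm_triangle_ineq[of "f x - p x" "g x - q x"]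
    by (simp add: algebra_simps)
  then show "\<exists>p\<in>P. \<forall>x\<in>S. norm (f x + g x - p x) < e"
    by (intro bexI[OF _ add[OF p(1) q(1)]]) simp
qed

lemma mult_ucl:
  assumes "f \<in> ucl P S" "g \<in> ucl P S"
  shows "(\<lambda>x. f x * g x) \<in> ucl P S"
  unfolding ucl_def
proof safe
  fix e :: real assume e: "e > 0"
  obtain C where C: "C > 0" "\<And>x. x \<in> S \<Longrightarrow> norm (f x) \<le> C"
    using bounded_ucl[OF assms(1)] by blast
  obtain q where q: "q \<in> P" "\<And>x. x \<in> S \<Longrightarrow> norm (g x - q x) < e / (2 * C)"
    using uclD[OF assms(2), of "e / (2*C)"] e C by auto
  obtain D where D: "D > 0" "\<And>x. x \<in> S \<Longrightarrow> norm (q x) \<le> D"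
    using bounded_ucl ucl_subset_gens q(1) by blast
  obtain p where p: "p \<in> P" "\<And>x. x \<in> S \<Longrightarrow> norm (f x - p x) < e / (2 * D)"
    using uclD[OF assms(1), of "e / (2*D)"] e D by auto
  have "norm (f x * g x - p x * q x) < e" if x: "x \<in> S" for x
  proof -
    have "f x * g x - p x * q x = f x * (g x - q x) + (f x - p x) * q x"
      by (simp add: algebra_simps)
    then have "norm (f x * g x - p x * q x) \<le> norm (f x) * norm (g x - q x) + norm (f x - p x) * norm (q x)"
      by (metis norm_mult norm_triangle_ineq)
    also have "norm (f x) * norm (g x - q x) \<le> C * norm (g x - q x)"
      by (intro mult_right_mono C(2) x) auto
    also have "C * norm (g x - q x) < e / 2" using q(2)[OF x] C(1) by (simp add: field_simps)
    also have "norm (f x - p x) * norm (q x) \<le> norm (f x - p x) * D"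
      by (intro mult_left_mono D(2) x) auto
    also have "norm (f x - p x) * D < e / 2" using p(2)[OF x] D(1) by (simp add: field_simps)
    finally show ?thesis by simp
  qed
  then show "\<exists>p\<in>P. \<forall>x\<in>S. norm (f x * g x - p x) < e"
    by (intro bexI[OF _ mult[OF p(1) q(1)]]) simp
qed

lemma cmult_ucl: "f \<in> ucl P S \<Longrightarrow> (\<lambda>x. c * f x) \<in> ucl P S"
  using mult_ucl[OF const_ucl] .

lemma diff_ucl:
  assumes "f \<in> ucl P S" "g \<in> ucl P S"
  shows "(\<lambda>x. f x - g x) \<in> ucl P S"
  using add_ucl[OF assms(1) cmult_ucl[OF assms(2), of "-1"]] by simp

lemma power_ucl: "f \<in> ucl P S \<Longrightarrow> (\<lambda>x. f x ^ n) \<in> ucl P S"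
  by (induction n) (auto intro: const_ucl mult_ucl)

lemma power_gen: "p \<in> P \<Longrightarrow> (\<lambda>x. p x ^ n) \<in> P"
  by (induction n) (auto intro: const mult)

lemma diff_gen:
  assumes "p \<in> P" "q \<in> P"
  shows "(\<lambda>x. p x - q x) \<in> P"
  using add[OF assms(1) mult[OF const[of "-1"] assms(2)]] by simp

lemma sum_ucl: "(\<And>k. k \<in> I \<Longrightarrow> f k \<in> ucl P S) \<Longrightarrow> (\<lambda>x. \<Sum>k\<in>I. f k x) \<in> ucl P S"
  by (induction I rule: infinite_finite_induct) (auto intro: const_ucl add_ucl)

lemma suminf_ucl:
  assumes "\<And>k. f k \<in> ucl P S" "\<And>k x. x \<in> S \<Longrightarrow> norm (f k x) \<le> M k" "summable M"
  shows "(\<lambda>x. \<Sum>k. f k x) \<in> ucl P S"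
proof (rule ucl_closed)
  fix e :: real assume "e > 0"
  have "uniform_limit S (\<lambda>n x. \<Sum>i<n. f i x) (\<lambda>x. \<Sum>i. f i x) sequentially"
    by (rule Weierstrass_m_test) (use assms in auto)
  from uniform_limitD[OF this \<open>e > 0\<close>]
  obtain n where "\<forall>x\<in>S. dist (\<Sum>i<n. f i x) (\<Sum>i. f i x) < e"
    by (auto simp: eventually_sequentially)
  then have "\<forall>x\<in>S. norm ((\<Sum>i. f i x) - (\<Sum>i<n. f i x)) < e"
    by (simp add: dist_norm norm_minus_commute)
  moreover have "(\<lambda>x. \<Sum>i<n. f i x) \<in> ucl P S"
    by (intro sum_ucl assms)
  ultimately show "\<exists>g\<in>ucl P S. \<forall>x\<in>S. norm ((\<Sum>i. f i x) - g x) < e"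
    by (rule bexI)
qed

text \<open>The binomial series of \<open>(1 + (f - 1)) powr a\<close> converges uniformly because
  \<open>r < 1\<close>. The exponents that occur later are 1/2, -1 and -1/2.\<close>

lemma powr_ucl:
  assumes f: "f \<in> ucl P S" and r: "r < 1" "\<And>x. x \<in> S \<Longrightarrow> norm (f x - 1) \<le> r"
  shows "(\<lambda>x. f x powr a) \<in> ucl P S"
proof (cases "S = {}")
  case True
  then show ?thesis using const by (auto simp: ucl_def)
next
  case False
  then have "0 \<le> r" using r(2) norm_ge_zero order_trans by blast
  have "summable (\<lambda>k. norm ((a gchoose k) * of_real r ^ k))"
  proof (rule abs_summable_in_conv_radius)
    show "ereal (norm (complex_of_real r)) < conv_radius (\<lambda>k. a gchoose k)"
      using r(1) \<open>0 \<le> r\<close> by (simp add: conv_radius_gchoose one_ereal_def)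
  qed
  then have "summable (\<lambda>k. norm (a gchoose k) * r ^ k)"
    using \<open>0 \<le> r\<close> by (simp add: norm_mult norm_power)
  then have *: "(\<lambda>x. \<Sum>k. (a gchoose k) * (f x - 1) ^ k) \<in> ucl P S"
  proof (rule suminf_ucl[rotated 2])
    show "(\<lambda>x. (a gchoose k) * (f x - 1) ^ k) \<in> ucl P S" for k
      by (intro cmult_ucl power_ucl diff_ucl f const_ucl)
    show "norm ((a gchoose k) * (f x - 1) ^ k) \<le> norm (a gchoose k) * r ^ k" if "x \<in> S" for k x
      using r(2)[OF that] by (auto simp: norm_mult norm_power intro!: mult_left_mono power_mono)
  qed
  show ?thesis
  proof (rule ucl_cong[OF *])
    fix x assume "x \<in> S"
    then have "norm (f x - 1) < 1" using r by fastforce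
    from gen_binomial_complex[OF this, of a]
    show "(\<Sum>k. (a gchoose k) * (f x - 1) ^ k) = f x powr a"
      by (simp add: sums_iff)
  qed
qed

lemma csqrt_ucl:
  assumes "f \<in> ucl P S" "r < 1" "\<And>x. x \<in> S \<Longrightarrow> norm (f x - 1) \<le> r"
  shows "(\<lambda>x. csqrt (f x)) \<in> ucl P S"
  unfolding csqrt_conv_powr by (rule powr_ucl[OF assms])

lemma inverse_ucl:
  assumes "f \<in> ucl P S" "r < 1" "\<And>x. x \<in> S \<Longrightarrow> norm (f x - 1) \<le> r"
  shows "(\<lambda>x. 1 / f x) \<in> ucl P S"
proof (rule ucl_cong[OF powr_ucl[OF assms, of "-1"]])
  fix x assume x: "x \<in> S"
  then have "f x \<noteq> 0" using assms(2) assms(3)[OF x] by auto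
  then show "f x powr -1 = 1 / f x" by (simp add: powr_minus_divide)
qed

text \<open>Since \<open>1 / f = g * (1 / (f * g))\<close>, an approximate inverse already proves
  invertibility. For polynomials such a bound on \<open>f * g - 1\<close> carries over from a set to
  its hull.\<close>

lemma inverse_ucl_approx:
  assumes "f \<in> ucl P S" "g \<in> ucl P S" "r < 1" "\<And>x. x \<in> S \<Longrightarrow> norm (f x * g x - 1) \<le> r"
  shows "(\<lambda>x. 1 / f x) \<in> ucl P S" "invertible_in P S f"
proof -
  have nz: "f x * g x \<noteq> 0" if "x \<in> S" for x
    using assms(3) assms(4)[OF that] by auto
  have "(\<lambda>x. 1 / (f x * g x)) \<in> ucl P S"
    by (rule inverse_ucl[OF mult_ucl[OF assms(1,2)] assms(3,4)])
  from mult_ucl[OF assms(2) this] show *: "(\<lambda>x. 1 / f x) \<in> ucl P S"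
    by (rule ucl_cong) (use nz in \<open>auto simp: divide_simps\<close>)
  show "invertible_in P S f" unfolding invertible_in_def
    using * assms(1) nz by (intro conjI bexI[OF _ *]) auto
qed

lemma invertible_inE:
  assumes "invertible_in P S g"
  obtains "g \<in> ucl P S" "(\<lambda>x. 1 / g x) \<in> ucl P S" "\<And>x. x \<in> S \<Longrightarrow> g x \<noteq> 0"
proof -
  obtain h where g: "g \<in> ucl P S" and h: "h \<in> ucl P S" "\<forall>x\<in>S. g x * h x = 1"
    using assms unfolding invertible_in_def by blast
  have nz: "g x \<noteq> 0" if "x \<in> S" for x using h(2) that by force
  have "(\<lambda>x. 1 / g x) \<in> ucl P S"
    by (rule ucl_cong[OF h(1)]) (use h(2) nz in \<open>auto simp: field_simps\<close>)
  with g nz show ?thesis using that by blast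
qed

lemma invertible_inI:
  assumes "g \<in> ucl P S" "h \<in> ucl P S" "\<And>x. x \<in> S \<Longrightarrow> g x * h x = 1"
  shows "invertible_in P S g"
  using assms unfolding invertible_in_def by blast

lemma invertible_in_mult:
  assumes "invertible_in P S f" "invertible_in P S g"
  shows "invertible_in P S (\<lambda>x. f x * g x)"
proof -
  from assms(1) obtain h where h: "f \<in> ucl P S" "h \<in> ucl P S" "\<forall>x\<in>S. f x * h x = 1"
    unfolding invertible_in_def by blast
  from assms(2) obtain k where k: "g \<in> ucl P S" "k \<in> ucl P S" "\<forall>x\<in>S. g x * k x = 1"
    unfolding invertible_in_def by blast
  show ?thesis
  proof (rule invertible_inI[OF mult_ucl[OF h(1) k(1)] mult_ucl[OF h(2) k(2)]])
    fix x assume "x \<in> S"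
    then have "f x * h x = 1" "g x * k x = 1" using h(3) k(3) by auto
    then show "f x * g x * (h x * k x) = 1"
      by (metis (no_types, opaque_lifting) mult.commute mult.left_commute mult_1)
  qed
qed

text \<open>With an inverse \<open>h\<close> bounded by \<open>C\<close>, a perturbation by less
  than \<open>1 / (2*C)\<close> leaves \<open>g * h\<close> within 1/2 of 1.\<close>

lemma invertible_in_nearby:
  assumes "invertible_in P S f"
  obtains d where "d > 0"
    "\<And>g. g \<in> ucl P S \<Longrightarrow> (\<And>x. x \<in> S \<Longrightarrow> norm (f x - g x) < d) \<Longrightarrow> invertible_in P S g"
proof -
  from assms obtain h where h: "f \<in> ucl P S" "h \<in> ucl P S" "\<forall>x\<in>S. f x * h x = 1"
    unfolding invertible_in_def by blast
  obtain C where C: "C > 0" "\<And>x. x \<in> S \<Longrightarrow> norm (h x) \<le> C"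
    using bounded_ucl[OF h(2)] by blast
  show ?thesis
  proof (rule that[of "1 / (2*C)"])
    show "1 / (2*C) > 0" using C by simp
    fix g assume g: "g \<in> ucl P S" and d: "\<And>x. x \<in> S \<Longrightarrow> norm (f x - g x) < 1 / (2*C)"
    show "invertible_in P S g"
    proof (rule inverse_ucl_approx(2)[OF g h(2), of "1/2"])
      fix x assume x: "x \<in> S"
      have "g x * h x - 1 = - ((f x - g x) * h x)" using h(3) x by (simp add: algebra_simps)
      then have "norm (g x * h x - 1) = norm (f x - g x) * norm (h x)" by (simp add: norm_mult)
      also have "\<dots> \<le> 1 / (2*C) * C" by (intro mult_mono C(2) x less_imp_le[OF d[OF x]]) (use C in auto)
      finally show "norm (g x * h x - 1) \<le> 1/2" using C by simp
    qed simp
  qed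
qed

end

section \<open>Density of invertible elements\<close>

definition dense_inv :: "('a \<Rightarrow> complex) set \<Rightarrow> 'a set \<Rightarrow> bool" where
  "dense_inv P S \<longleftrightarrow> (\<forall>f\<in>ucl P S. \<forall>e>0. \<exists>g. invertible_in P S g \<and> (\<forall>x\<in>S. norm (f x - g x) < e))"

lemma dense_invI:
  assumes "\<And>p e. p \<in> P \<Longrightarrow> e > 0 \<Longrightarrow> \<exists>g. invertible_in P S g \<and> (\<forall>x\<in>S. norm (p x - g x) < e)"
  shows "dense_inv P S"
  unfolding dense_inv_def
proof safe
  fix f and e :: real assume f: "f \<in> ucl P S" and e: "e > 0"
  obtain p where p: "p \<in> P" "\<And>x. x \<in> S \<Longrightarrow> norm (f x - p x) < e/2"
    using uclD[OF f] e by (metis half_gt_zero)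
  obtain g where "invertible_in P S g" "\<forall>x\<in>S. norm (p x - g x) < e/2"
    using assms[OF p(1), of "e/2"] e by auto
  with p(2) show "\<exists>g. invertible_in P S g \<and> (\<forall>x\<in>S. norm (f x - g x) < e)"
    by (metis norm_diff_triangle_less field_sum_of_halves)
qed

text \<open>The approximant is found among the generators and not merely in their closure:
  invertibles form an open set, so a generator close enough to an invertible element is itself
  invertible.\<close>

lemma dense_inv_approx:
  assumes "fun_algebra P S" "dense_inv P S" "f \<in> ucl P S" "e > 0"
  obtains p where "p \<in> P" "invertible_in P S p" "\<And>x. x \<in> S \<Longrightarrow> norm (f x - p x) < e"
proof -
  interpret fun_algebra P S by fact
  obtain g where g: "invertible_in P S g" "\<forall>x\<in>S. norm (f x - g x) < e/2"
    using assms unfolding dense_inv_def by (metis half_gt_zero)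
  obtain d where d: "d > 0"
    "\<And>h. h \<in> ucl P S \<Longrightarrow> (\<And>x. x \<in> S \<Longrightarrow> norm (g x - h x) < d) \<Longrightarrow> invertible_in P S h"
    using invertible_in_nearby[OF g(1)] by blast
  have "g \<in> ucl P S" using g(1) by (simp add: invertible_in_def)
  then obtain p where p: "p \<in> P" "\<And>x. x \<in> S \<Longrightarrow> norm (g x - p x) < min d (e/2)"
    using uclD[of g P S "min d (e/2)"] d(1) \<open>e > 0\<close> by auto
  have "p \<in> ucl P S" using p(1) ucl_subset_gens by blast
  have "norm (f x - p x) < e" if "x \<in> S" for x
    using g(2) p(2)[OF that] that norm_diff_triangle_less[of "f x" "g x" "e/2" "p x" "e/2"] by auto
  then show ?thesis using that p d(2)[OF \<open>p \<in> ucl P S\<close>] by force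
qed

lemma invertible_in_transfer:
  assumes "P \<subseteq> ucl Q T" "T \<subseteq> S" "invertible_in P S g"
  shows "invertible_in Q T g"
  using assms ucl_subset[of P Q T S] unfolding invertible_in_def by blast

text \<open>If \<open>a + b t\<close> is given with \<open>t\<^sup>2 = f\<close>, perturbing \<open>b\<close> amounts to perturbing \<open>f\<close>, so the norm
  \<open>a\<^sup>2 - b\<^sup>2 f\<close> can be made equal to any nearby invertible element.\<close>

lemma norm_form_perturb:
  assumes "fun_algebra P S" "dense_inv P S" and a: "a \<in> ucl P S" and b: "b \<in> ucl P S"
    and f: "invertible_in P S f" and e: "e > 0"
  obtains b' where "b' \<in> ucl P S" "\<And>x. x \<in> S \<Longrightarrow> norm (b x - b' x) < e"
    "invertible_in P S (\<lambda>x. (a x)\<^sup>2 - (b' x)\<^sup>2 * f x)"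
proof -
  interpret fun_algebra P S by fact
  \<comment> \<open>With \<open>b1\<close> invertible, so is \<open>k = b1^2 f\<close>. For an
    invertible \<open>h\<close> near \<open>a^2 - k\<close>, the equation
    \<open>a^2 - b'^2 f = h\<close> reads \<open>b'^2 = b1^2 u\<close> with
    \<open>u = (a^2 - h) / k\<close> near 1, and \<open>b' = b1 * csqrt u\<close> solves it.\<close>
  obtain b1 where b1: "b1 \<in> P" "invertible_in P S b1" "\<And>x. x \<in> S \<Longrightarrow> norm (b x - b1 x) < e/2"
    using dense_inv_approx[OF assms(1,2) b, of "e/2"] e by auto
  have b1u: "b1 \<in> ucl P S" using b1 ucl_subset_gens by blast
  have fu: "f \<in> ucl P S" using f by (simp add: invertible_in_def)
  define k where "k = (\<lambda>x. b1 x * b1 x * f x)"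
  have "invertible_in P S k" unfolding k_def by (intro invertible_in_mult b1 f)
  then obtain ku: "k \<in> ucl P S" and ik: "(\<lambda>x. 1 / k x) \<in> ucl P S" and knz: "\<And>x. x \<in> S \<Longrightarrow> k x \<noteq> 0"
    by (rule invertible_inE) blast
  obtain C where C: "C > 0" "\<And>x. x \<in> S \<Longrightarrow> norm (1 / k x) \<le> C"
    using bounded_ucl[OF ik] by blast
  obtain D where D: "D > 0" "\<And>x. x \<in> S \<Longrightarrow> norm (b1 x) \<le> D"
    using bounded_ucl[OF b1u] by blast
  \<comment> \<open>Division by \<open>C\<close> compensates the factor \<open>1 / k\<close>. The
    bound 1/2 on \<open>u - 1\<close> lets the root exist, and \<open>e / (2*D)\<close> makes the
    factor \<open>b1\<close> cost at most \<open>e/2\<close>.\<close>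
  define d where "d = min (1/2) (e / (2*D)) / C"
  have d: "d > 0" using C D e by (simp add: d_def)
  have ak: "(\<lambda>x. (a x)\<^sup>2 - k x) \<in> ucl P S" by (intro diff_ucl power_ucl a ku)
  obtain h where h: "h \<in> P" "invertible_in P S h" "\<And>x. x \<in> S \<Longrightarrow> norm ((a x)\<^sup>2 - k x - h x) < d"
    by (rule dense_inv_approx[OF assms(1,2) ak d]) blast
  define u where "u = (\<lambda>x. ((a x)\<^sup>2 - h x) * (1 / k x))"
  have hu: "h \<in> ucl P S" using h ucl_subset_gens by blast
  have uu: "u \<in> ucl P S" unfolding u_def by (intro diff_ucl power_ucl a hu mult_ucl ik)
  have u1: "norm (u x - 1) \<le> min (1/2) (e / (2*D))" if x: "x \<in> S" for x
  proof -
    have "u x - 1 = ((a x)\<^sup>2 - k x - h x) * (1 / k x)"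
      using knz[OF x] by (simp add: u_def field_simps)
    then have "norm (u x - 1) \<le> d * C"
      using mult_mono[OF less_imp_le[OF h(3)[OF x]] C(2)[OF x]] d by (simp add: norm_mult norm_divide)
    then show ?thesis using C by (simp add: d_def)
  qed
  define g where "g = (\<lambda>x. csqrt (u x))"
  have gu: "g \<in> ucl P S" unfolding g_def
    by (rule csqrt_ucl[OF uu, of "1/2"]) (use u1 in auto)
  \<comment> \<open>The principal root has nonnegative real part, so
    \<open>norm (g x + 1) \<ge> 1\<close> and \<open>g x - 1 = (u x - 1) / (g x + 1)\<close> is no
    larger than \<open>u x - 1\<close>.\<close>
  have g1: "norm (g x - 1) \<le> norm (u x - 1)" for x
  proof -
    have "u x - 1 = (g x - 1) * (g x + 1)"
      using power2_csqrt[of "u x"] by (simp add: g_def algebra_simps power2_eq_square del: csqrt.sel power2_csqrt)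
    moreover have "norm (g x + 1) \<ge> 1"
      using complex_Re_le_cmod[of "g x + 1"] Re_csqrt[of "u x"] by (simp add: g_def del: csqrt.sel)
    ultimately show ?thesis
      by (metis mult_left_mono norm_ge_zero norm_mult mult.right_neutral)
  qed
  show ?thesis
  proof (rule that[of "\<lambda>x. b1 x * g x"])
    show "(\<lambda>x. b1 x * g x) \<in> ucl P S" by (intro mult_ucl b1u gu)
    show "norm (b x - b1 x * g x) < e" if x: "x \<in> S" for x
    proof -
      have "norm (b1 x - b1 x * g x) = norm (b1 x) * norm (g x - 1)"
        by (metis norm_minus_commute norm_mult right_diff_distrib' mult.right_neutral)
      also have "\<dots> \<le> D * (e / (2*D))"
        by (intro mult_mono D(2) x) (use D u1[OF x] g1[of x] in auto)
      also have "\<dots> = e/2" using D by simp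
      finally show ?thesis using b1(3)[OF x] norm_triangle_ineq[of "b x - b1 x" "b1 x - b1 x * g x"] by simp
    qed
    show "invertible_in P S (\<lambda>x. (a x)\<^sup>2 - (b1 x * g x)\<^sup>2 * f x)"
    proof (rule invertible_inE[OF h(2)], rule invertible_inI)
      assume ih: "(\<lambda>x. 1 / h x) \<in> ucl P S" and hnz: "\<And>x. x \<in> S \<Longrightarrow> h x \<noteq> 0"
      show "(\<lambda>x. (a x)\<^sup>2 - (b1 x * g x)\<^sup>2 * f x) \<in> ucl P S"
        by (intro diff_ucl mult_ucl power_ucl a b1u gu fu)
      show "(\<lambda>x. 1 / h x) \<in> ucl P S" by fact
      show "((a x)\<^sup>2 - (b1 x * g x)\<^sup>2 * f x) * (1 / h x) = 1" if x: "x \<in> S" for x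
      proof -
        have "(b1 x * g x)\<^sup>2 * f x = k x * u x"
          by (simp add: k_def g_def power_mult_distrib power2_eq_square[of "b1 x"])
        also have "\<dots> = (a x)\<^sup>2 - h x" using knz[OF x] by (simp add: u_def)
        finally show ?thesis using hnz[OF x] by simp
      qed
    qed
  qed
qed

subsection \<open>Polynomial hulls\<close>

lemma cpoly_bounded:
  fixes S :: "(complex^'n::finite) set"
  assumes "bounded S" "p \<in> cpoly"
  shows "\<exists>C. \<forall>x\<in>S. norm (p x) \<le> C"
  using assms(2)
proof induction
  case (coord i)
  obtain B where "\<forall>x\<in>S. norm x \<le> B" using assms(1) bounded_iff by blast
  then have "\<forall>x\<in>S. norm (x $ i) \<le> B" using Finite_Cartesian_Product.norm_nth_le order_trans by blast
  then show ?case by blast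
next
  case (add p q)
  then obtain C D where "\<forall>x\<in>S. norm (p x) \<le> C" "\<forall>x\<in>S. norm (q x) \<le> D" by blast
  then have "\<forall>x\<in>S. norm (p x + q x) \<le> C + D" by (meson add_mono norm_triangle_le)
  then show ?case by blast
next
  case (mult p q)
  then obtain C D where CD: "\<forall>x\<in>S. norm (p x) \<le> C" "\<forall>x\<in>S. norm (q x) \<le> D" by blast
  have "norm (p x * q x) \<le> C * D" if "x \<in> S" for x
    unfolding norm_mult using CD that by (intro mult_mono) (auto intro: order_trans[OF norm_ge_zero])
  then show ?case by blast
qed auto

lemma fun_algebra_cpoly:
  fixes S :: "(complex^'n::finite) set"
  assumes "bounded S"
  shows "fun_algebra cpoly S"
  by unfold_locales (auto intro: cpoly.intros cpoly_bounded[OF assms])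

lemma phullD:
  assumes "z \<in> phull Y" "Y \<noteq> {}" "p \<in> cpoly" "\<And>y. y \<in> Y \<Longrightarrow> norm (p y) \<le> C"
  shows "norm (p z) \<le> C"
proof -
  have "norm (p z) \<le> (SUP x\<in>Y. norm (p x))" using assms(1,3) by (simp add: phull_def)
  also have "\<dots> \<le> C" by (rule cSUP_least) (use assms in auto)
  finally show ?thesis .
qed

lemma cpoly_le_SUP:
  fixes Y :: "(complex^'n::finite) set"
  assumes "bounded Y" "p \<in> cpoly" "y \<in> Y"
  shows "norm (p y) \<le> (SUP x\<in>Y. norm (p x))"
proof (rule cSUP_upper[OF assms(3)])
  obtain C where "\<forall>x\<in>Y. norm (p x) \<le> C" using cpoly_bounded[OF assms(1,2)] by blast
  then show "bdd_above ((\<lambda>x. norm (p x)) ` Y)" by (intro bdd_aboveI2) auto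
qed

lemma phullI:
  fixes Y :: "(complex^'n::finite) set"
  assumes "bounded Y"
    and "\<And>p C. p \<in> cpoly \<Longrightarrow> (\<And>y. y \<in> Y \<Longrightarrow> norm (p y) \<le> C) \<Longrightarrow> norm (p z) \<le> C"
  shows "z \<in> phull Y"
  unfolding phull_def using assms(2) cpoly_le_SUP[OF assms(1)] by blast

lemma subset_phull:
  fixes Y :: "(complex^'n::finite) set"
  shows "bounded Y \<Longrightarrow> Y \<subseteq> phull Y"
  by (auto intro: phullI)

lemma bounded_phull:
  fixes Y :: "(complex^'n::finite) set"
  assumes "bounded Y" "Y \<noteq> {}"
  shows "bounded (phull Y)"
proof -
  obtain B where B: "\<And>y. y \<in> Y \<Longrightarrow> norm y \<le> B" using assms(1) bounded_iff by blast
  have "norm z \<le> (\<Sum>i\<in>(UNIV::'n set). B)" if "z \<in> phull Y" for z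
  proof -
    have "norm z \<le> (\<Sum>i\<in>UNIV. norm (z $ i))" unfolding norm_vec_def by (rule L2_set_le_sum) auto
    also have "\<dots> \<le> (\<Sum>i\<in>(UNIV::'n set). B)"
    proof (rule sum_mono)
      fix i
      show "norm (z $ i) \<le> B"
        by (rule phullD[OF that assms(2) cpoly.coord]) (use B Finite_Cartesian_Product.norm_nth_le order_trans in blast)
    qed
    finally show ?thesis .
  qed
  then show ?thesis by (auto simp: bounded_iff)
qed

text \<open>An inverse known only on \<open>Y\<close> is replaced by a polynomial \<open>r\<close>
  with \<open>norm (q x * r x - 1) \<le> 1/2\<close> on \<open>Y\<close>. As a bound for a
  polynomial this persists on the hull, where it makes \<open>q\<close> invertible.\<close>

lemma dense_inv_phull:
  fixes Y :: "(complex^'n::finite) set"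
  assumes Y: "bounded Y" "Y \<noteq> {}" "dense_invertibles Y"
  shows "dense_inv cpoly (phull Y)"
proof (rule dense_invI)
  fix p :: "complex^'n \<Rightarrow> complex" and e :: real
  assume p: "p \<in> cpoly" and e: "e > 0"
  interpret K: fun_algebra cpoly "phull Y" by (rule fun_algebra_cpoly[OF bounded_phull[OF Y(1,2)]])
  interpret Y: fun_algebra cpoly Y by (rule fun_algebra_cpoly[OF Y(1)])
  have pu: "p \<in> PX Y" using p ucl_subset_gens by (auto simp: PX_eq_ucl)
  obtain g h where g: "g \<in> ucl cpoly Y" "supn Y (\<lambda>x. p x - g x) < e/2"
      and h: "h \<in> ucl cpoly Y" "\<forall>x\<in>Y. g x * h x = 1"
    using Y(3)[unfolded dense_invertibles_def, rule_format, OF pu, of "e/2"] e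
    unfolding PX_eq_ucl by auto
  obtain C where C: "\<And>x. x \<in> Y \<Longrightarrow> norm (p x - g x) \<le> C"
    using Y.bounded_ucl[OF Y.diff_ucl[OF pu[unfolded PX_eq_ucl] g(1)]] by blast
  have pg: "norm (p x - g x) < e/2" if "x \<in> Y" for x
  proof -
    have "norm (p x - g x) \<le> supn Y (\<lambda>x. p x - g x)"
      unfolding supn_def by (rule cSUP_upper[OF that]) (auto intro!: bdd_aboveI2 C)
    with g(2) show ?thesis by simp
  qed
  have "invertible_in cpoly Y g" using g h by (auto simp: invertible_in_def)
  then obtain d where d: "d > 0"
    "\<And>f. f \<in> ucl cpoly Y \<Longrightarrow> (\<And>x. x \<in> Y \<Longrightarrow> norm (g x - f x) < d) \<Longrightarrow> invertible_in cpoly Y f"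
    using Y.invertible_in_nearby by blast
  \<comment> \<open>\<open>e/4\<close>, added to the \<open>e/2\<close> spent on \<open>g\<close>,
    gives the closed bound \<open>3/4 * e\<close>, which passes to the hull and stays strictly below
    \<open>e\<close> there.\<close>
  obtain q where q: "q \<in> cpoly" "\<And>x. x \<in> Y \<Longrightarrow> norm (g x - q x) < min d (e/4)"
    using uclD[OF g(1), of "min d (e/4)"] d(1) e by auto
  have "invertible_in cpoly Y q"
    using d(2)[of q] q subsetD[OF ucl_subset_gens q(1)] by force
  then obtain h' where h': "h' \<in> ucl cpoly Y" "\<forall>x\<in>Y. q x * h' x = 1"
    by (auto simp: invertible_in_def)
  obtain D where D: "D > 0" "\<And>x. x \<in> Y \<Longrightarrow> norm (q x) \<le> D"
    using Y.bounded_ucl[OF subsetD[OF ucl_subset_gens q(1)]] by blast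
  obtain r where r: "r \<in> cpoly" "\<And>x. x \<in> Y \<Longrightarrow> norm (h' x - r x) < 1 / (2*D)"
    using uclD[OF h'(1), of "1/(2*D)"] D(1) by auto
  have qr: "norm (q x * r x - 1) \<le> 1/2" if x: "x \<in> Y" for x
  proof -
    have "q x * r x - 1 = - (q x * (h' x - r x))" using h'(2) x by (simp add: algebra_simps)
    then have "norm (q x * r x - 1) = norm (q x) * norm (h' x - r x)"
      by (metis norm_minus_cancel norm_mult)
    also have "\<dots> \<le> D * (1 / (2*D))"
      by (intro mult_mono D(2) x less_imp_le[OF r(2)[OF x]]) (use D in auto)
    finally show ?thesis using D by simp
  qed
  have "norm (q z * r z - 1) \<le> 1/2" if "z \<in> phull Y" for z
    by (rule phullD[OF that Y(2) Y.diff_gen[OF Y.mult[OF q(1) r(1)] Y.const[of 1]] qr])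
  then have "invertible_in cpoly (phull Y) q"
    by (intro K.inverse_ucl_approx(2)[OF subsetD[OF ucl_subset_gens q(1)] subsetD[OF ucl_subset_gens r(1)], of "1/2"]) auto
  moreover have "norm (p z - q z) < e" if "z \<in> phull Y" for z
  proof -
    have *: "norm (p y - q y) \<le> 3/4 * e" if "y \<in> Y" for y
      using pg[OF that] q(2)[OF that] norm_triangle_ineq[of "p y - g y" "g y - q y"] by simp
    have "norm (p z - q z) \<le> 3/4 * e"
      by (rule phullD[OF that Y(2) Y.diff_gen[OF p q(1)] *])
    with e show ?thesis by simp
  qed
  ultimately show "\<exists>g. invertible_in cpoly (phull Y) g \<and> (\<forall>z\<in>phull Y. norm (p z - g z) < e)" by blast
qed

subsection \<open>Towers of square roots\<close>

text \<open>Polynomials as syntax: the recursion for the tower selects them by natural numbers, so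
  they must form a countable type, whence the rational real and imaginary parts in
  \<open>Cst\<close>. \<open>Tvar j\<close> stands for the root adjoined at step
  \<open>j\<close>.\<close>

datatype 'n pexp = Cst rat rat | Zvar 'n | Tvar nat | Add "'n pexp" "'n pexp" | Mult "'n pexp" "'n pexp"

instance pexp :: (countable) countable
  by countable_datatype

type_synonym 'n pt = "(complex^'n) \<times> (nat \<Rightarrow> complex)"

fun ev :: "'n::finite pexp \<Rightarrow> 'n pt \<Rightarrow> complex" where
  "ev (Cst a b) x = Complex (of_rat a) (of_rat b)"
| "ev (Zvar i) x = fst x $ i"
| "ev (Tvar j) x = snd x j"
| "ev (Add p q) x = ev p x + ev q x"
| "ev (Mult p q) x = ev p x * ev q x"

fun tvars :: "'n pexp \<Rightarrow> nat set" where
  "tvars (Cst a b) = {}"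
| "tvars (Zvar i) = {}"
| "tvars (Tvar j) = {j}"
| "tvars (Add p q) = tvars p \<union> tvars q"
| "tvars (Mult p q) = tvars p \<union> tvars q"

inductive_set tpoly :: "nat \<Rightarrow> ('n::finite pt \<Rightarrow> complex) set" for k :: nat where
  const: "(\<lambda>x. c) \<in> tpoly k"
| zvar: "(\<lambda>x. fst x $ i) \<in> tpoly k"
| tvar: "j < k \<Longrightarrow> (\<lambda>x. snd x j) \<in> tpoly k"
| add: "p \<in> tpoly k \<Longrightarrow> q \<in> tpoly k \<Longrightarrow> (\<lambda>x. p x + q x) \<in> tpoly k"
| mult: "p \<in> tpoly k \<Longrightarrow> q \<in> tpoly k \<Longrightarrow> (\<lambda>x. p x * q x) \<in> tpoly k"

lemma tpoly_mono: "p \<in> tpoly k \<Longrightarrow> k \<le> l \<Longrightarrow> p \<in> tpoly l"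
  by (induction rule: tpoly.induct) (simp_all add: tpoly.intros)

lemma tpoly_cong:
  assumes "p \<in> tpoly k" "fst x = fst y" "\<And>j. j < k \<Longrightarrow> snd x j = snd y j"
  shows "p x = p y"
  using assms by (induction rule: tpoly.induct) auto

lemma ev_tpoly: "(\<And>j. j \<in> tvars e \<Longrightarrow> j < k) \<Longrightarrow> ev e \<in> tpoly k"
proof (induction e)
  case (Cst a b)
  have "ev (Cst a b) = (\<lambda>x. Complex (of_rat a) (of_rat b))" by auto
  then show ?case by (simp add: tpoly.const)
next
  case (Zvar i)
  have "ev (Zvar i) = (\<lambda>x. fst x $ i)" by auto
  then show ?case by (simp add: tpoly.zvar)
next
  case (Tvar j)
  have "ev (Tvar j) = (\<lambda>x. snd x j)" by auto
  then show ?case using Tvar by (simp add: tpoly.tvar)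
next
  case (Add p q)
  have "ev (Add p q) = (\<lambda>x. ev p x + ev q x)" by auto
  then show ?case using Add by (simp add: tpoly.add)
next
  case (Mult p q)
  have "ev (Mult p q) = (\<lambda>x. ev p x * ev q x)" by auto
  then show ?case using Mult by (simp add: tpoly.mult)
qed

lemma tpoly_bounded:
  assumes p: "p \<in> tpoly k" and B: "bounded (fst ` S)"
    and T: "\<And>j. j < k \<Longrightarrow> \<exists>C. \<forall>x\<in>S. norm (snd x j) \<le> C"
  shows "\<exists>C. \<forall>x\<in>S. norm (p x) \<le> C"
  using p
proof induction
  case (zvar i)
  show ?case using cpoly_bounded[OF B cpoly.coord[of i]] by auto
next
  case (add p q)
  then obtain C D where "\<forall>x\<in>S. norm (p x) \<le> C" "\<forall>x\<in>S. norm (q x) \<le> D" by blast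
  then have "\<forall>x\<in>S. norm (p x + q x) \<le> C + D" by (meson add_mono norm_triangle_le)
  then show ?case by blast
next
  case (mult p q)
  then obtain C D where CD: "\<forall>x\<in>S. norm (p x) \<le> C" "\<forall>x\<in>S. norm (q x) \<le> D" by blast
  have "norm (p x * q x) \<le> C * D" if "x \<in> S" for x
    unfolding norm_mult using CD that by (intro mult_mono) (auto intro: order_trans[OF norm_ge_zero])
  then show ?case by blast
qed (use T in auto)

lemma rational_complex_dense:
  assumes "e > 0"
  obtains a b where "norm (c - Complex (of_rat a) (of_rat b)) < e"
proof -
  obtain a where a: "Re c < of_rat a" "of_rat a < Re c + e/2" using of_rat_dense[of "Re c" "Re c + e/2"] assms by auto
  obtain b where b: "Im c < of_rat b" "of_rat b < Im c + e/2" using of_rat_dense[of "Im c" "Im c + e/2"] assms by auto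
  have "norm (c - Complex (of_rat a) (of_rat b)) \<le> \<bar>Re c - of_rat a\<bar> + \<bar>Im c - of_rat b\<bar>"
    using cmod_le[of "c - Complex (of_rat a) (of_rat b)"] by simp
  also have "\<dots> < e" using a b by simp
  finally show ?thesis by (rule that)
qed

text \<open>Rational approximation of the coefficients. The functions \<open>ev e\<close> lack most
  constants and so do not form a \<open>fun_algebra\<close>; closure under sums and products is
  therefore checked by hand.\<close>

lemma tpoly_approx_ev:
  assumes S: "fun_algebra (tpoly k) S" and p: "p \<in> tpoly k"
  shows "p \<in> ucl {ev e |e. \<forall>j\<in>tvars e. j < k} S"
proof -
  let ?Q = "{ev e |e. \<forall>j\<in>tvars e. j < k}"
  interpret fun_algebra "tpoly k" S by fact
  have Q: "\<exists>a. (\<forall>j\<in>tvars a. j < k) \<and> (\<forall>x\<in>S. norm (p x - ev a x) < e)"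
    if "p \<in> ucl ?Q S" "e > 0" for p e
    using that unfolding ucl_def by blast
  have Qadd: "(\<lambda>x. p x + q x) \<in> ucl ?Q S" if pq: "p \<in> ucl ?Q S" "q \<in> ucl ?Q S" for p q
    unfolding ucl_def
  proof safe
    fix e :: real assume e: "e > 0"
    obtain a where a: "\<forall>j\<in>tvars a. j < k" "\<forall>x\<in>S. norm (p x - ev a x) < e/2"
      using Q[OF pq(1), of "e/2"] e by auto
    obtain b where b: "\<forall>j\<in>tvars b. j < k" "\<forall>x\<in>S. norm (q x - ev b x) < e/2"
      using Q[OF pq(2), of "e/2"] e by auto
    have "norm (p x + q x - ev (Add a b) x) < e" if "x \<in> S" for x
      using bspec[OF a(2) that] bspec[OF b(2) that] norm_triangle_ineq[of "p x - ev a x" "q x - ev b x"]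
      by (simp add: algebra_simps)
    moreover have "ev (Add a b) \<in> ?Q" using a(1) b(1) by (intro CollectI exI[of _ "Add a b"]) auto
    ultimately show "\<exists>r\<in>?Q. \<forall>x\<in>S. norm (p x + q x - r x) < e" by (intro bexI[of _ "ev (Add a b)"]) auto
  qed
  have Qmult: "(\<lambda>x. p x * q x) \<in> ucl ?Q S" if pq: "p \<in> ucl ?Q S" "q \<in> ucl ?Q S" and pq': "p \<in> tpoly k" for p q
    unfolding ucl_def
  proof safe
    fix e :: real assume e: "e > 0"
    obtain C where C: "C > 0" "\<And>x. x \<in> S \<Longrightarrow> norm (p x) \<le> C"
      using bounded_ucl[OF subsetD[OF ucl_subset_gens pq']] by blast
    obtain b where b: "\<forall>j\<in>tvars b. j < k" "\<forall>x\<in>S. norm (q x - ev b x) < e / (2*C)"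
      using Q[OF pq(2), of "e/(2*C)"] e C(1) by auto
    obtain D where D: "D > 0" "\<And>x. x \<in> S \<Longrightarrow> norm (ev b x) \<le> D"
      using bounded_ucl[OF subsetD[OF ucl_subset_gens ev_tpoly[of b k]]] b(1) by blast
    obtain a where a: "\<forall>j\<in>tvars a. j < k" "\<forall>x\<in>S. norm (p x - ev a x) < e / (2*D)"
      using Q[OF pq(1), of "e/(2*D)"] e D(1) by auto
    have "norm (p x * q x - ev (Mult a b) x) < e" if x: "x \<in> S" for x
    proof -
      have "p x * q x - ev (Mult a b) x = p x * (q x - ev b x) + (p x - ev a x) * ev b x"
        by (simp add: algebra_simps)
      then have "norm (p x * q x - ev (Mult a b) x) \<le> norm (p x) * norm (q x - ev b x) + norm (p x - ev a x) * norm (ev b x)"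
        by (metis norm_mult norm_triangle_ineq)
      also have "norm (p x) * norm (q x - ev b x) \<le> C * norm (q x - ev b x)"
        by (intro mult_right_mono C(2) x) auto
      also have "C * norm (q x - ev b x) < e / 2" using bspec[OF b(2) x] C(1) by (simp add: field_simps)
      also have "norm (p x - ev a x) * norm (ev b x) \<le> norm (p x - ev a x) * D"
        by (intro mult_left_mono D(2) x) auto
      also have "norm (p x - ev a x) * D < e / 2" using bspec[OF a(2) x] D(1) by (simp add: field_simps)
      finally show ?thesis by simp
    qed
    moreover have "ev (Mult a b) \<in> ?Q" using a(1) b(1) by (intro CollectI exI[of _ "Mult a b"]) auto
    ultimately show "\<exists>r\<in>?Q. \<forall>x\<in>S. norm (p x * q x - r x) < e" by (intro bexI[of _ "ev (Mult a b)"]) auto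
  qed
  show ?thesis using p
  proof induction
    case (const c)
    show ?case unfolding ucl_def
    proof safe
      fix e :: real assume "e > 0"
      obtain a b where ab: "norm (c - Complex (of_rat a) (of_rat b)) < e"
        using rational_complex_dense[OF \<open>e > 0\<close>] by blast
      have "ev (Cst a b) \<in> ?Q" by (intro CollectI exI[of _ "Cst a b"]) auto
      then show "\<exists>p\<in>?Q. \<forall>x\<in>S. norm (c - p x) < e"
        using ab by (intro bexI[of _ "ev (Cst a b)"]) auto
    qed
  next
    case (zvar i)
    have "(\<lambda>x. fst x $ i) = ev (Zvar i)" by auto
    then have "(\<lambda>x. fst x $ i) \<in> ?Q" by (intro CollectI exI[of _ "Zvar i"]) auto
    then show ?case by (rule subsetD[OF ucl_subset_gens])
  next
    case (tvar j)
    have "(\<lambda>x. snd x j) = ev (Tvar j)" by auto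
    then have "(\<lambda>x. snd x j) \<in> ?Q" using tvar by (intro CollectI exI[of _ "Tvar j"]) auto
    then show ?case by (rule subsetD[OF ucl_subset_gens])
  next
    case (add p q)
    then show ?case using Qadd by simp
  next
    case (mult p q)
    then show ?case using Qmult by simp
  qed
qed

definition legal :: "'n::finite pt set \<Rightarrow> nat \<Rightarrow> 'n pexp \<Rightarrow> bool" where
  "legal S k e \<longleftrightarrow> (\<forall>j\<in>tvars e. j < k) \<and> invertible_in (tpoly k) S (ev e)"

text \<open>Decoding \<open>k\<close> as a pair makes every expression come up for arbitrarily large \<open>k\<close>, hence also
  at a stage where all its variables are available.\<close>

definition root_exp :: "'n::finite pt set \<Rightarrow> nat \<Rightarrow> 'n pexp" where
  "root_exp S k = (let e = from_nat (fst (prod_decode k)) in if legal S k e then e else Cst 1 0)"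

text \<open>Stage \<open>k\<close> is a cylinder in the space of all sequences: it constrains the
  coordinates below \<open>k\<close> and leaves the rest free. All stages thus live in one type and
  the limit is an intersection. The next radicand depends on the stage built so far, because
  legality means invertibility there.\<close>

primrec tower :: "(complex^'n::finite) set \<Rightarrow> nat \<Rightarrow> 'n pt set" where
  "tower K 0 = {x. fst x \<in> K}"
| "tower K (Suc k) = {x \<in> tower K k. (snd x k)\<^sup>2 = ev (root_exp (tower K k) k) x}"

text \<open>If \<open>norm l > C\<close>, the product bound forces \<open>norm m \<le> C\<close>, so
  \<open>norm l ^ n \<le> 3 * C ^ n\<close> for all \<open>n\<close>, which fails for large
  \<open>n\<close>. It is meant for two conjugate values of a polynomial, whose power sums and
  product descend one stage.\<close>

lemma power_sum_bound:
  fixes l m :: complex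
  assumes sum: "\<And>n. norm (l ^ n + m ^ n) \<le> 2 * C ^ n" and prod: "norm (l * m) \<le> C\<^sup>2" and C: "C \<ge> 0"
  shows "norm l \<le> C"
proof (rule ccontr)
  assume "\<not> norm l \<le> C"
  then have lC: "norm l > C" by simp
  have "norm m \<le> C"
  proof (rule ccontr)
    assume "\<not> norm m \<le> C"
    then have "C * C < norm l * norm m" using lC C by (intro mult_strict_mono') auto
    with prod show False by (simp add: norm_mult power2_eq_square)
  qed
  have le3: "norm l ^ n \<le> 3 * C ^ n" for n
  proof -
    have "norm l ^ n \<le> norm (l ^ n + m ^ n) + norm (m ^ n)"
      using norm_triangle_ineq4[of "l ^ n + m ^ n" "m ^ n"] by (simp add: norm_power)
    also have "\<dots> \<le> 2 * C ^ n + C ^ n"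
      using sum[of n] power_mono[OF \<open>norm m \<le> C\<close>, of n] by (simp add: norm_power)
    finally show ?thesis by simp
  qed
  show False
  proof (cases "C = 0")
    case True
    then show ?thesis using le3[of 1] lC by simp
  next
    case False
    then have "norm l / C > 1" using lC C by simp
    then obtain n where "3 < (norm l / C) ^ n" using real_arch_pow by blast
    then show False using le3[of n] False C by (simp add: power_divide field_simps)
  qed
qed

lemma cpoly_tpoly: "p \<in> cpoly \<Longrightarrow> (\<lambda>x. p (fst x)) \<in> tpoly 0"
  by (induction rule: cpoly.induct) (auto intro: tpoly.intros)

lemma tpoly_0:
  assumes "p \<in> tpoly 0"
  shows "\<exists>q\<in>cpoly. p = (\<lambda>x. q (fst x))"
  using assms
proof induction
  case (const c)
  show ?case by (rule bexI[OF _ cpoly.const]) simp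
next
  case (zvar i)
  show ?case by (rule bexI[OF _ cpoly.coord]) simp
next
  case (add p q)
  then obtain p' q' where "p' \<in> cpoly" "q' \<in> cpoly" "p = (\<lambda>x. p' (fst x))" "q = (\<lambda>x. q' (fst x))"
    by blast
  then show ?case by (intro bexI[OF _ cpoly.add[of p' q']]) auto
next
  case (mult p q)
  then obtain p' q' where "p' \<in> cpoly" "q' \<in> cpoly" "p = (\<lambda>x. p' (fst x))" "q = (\<lambda>x. q' (fst x))"
    by blast
  then show ?case by (intro bexI[OF _ cpoly.mult[of p' q']]) auto
qed auto

section \<open>The finite stages: density of invertibles and the maximum principle\<close>

locale sqrt_tower =
  fixes Y :: "(complex^'n::finite) set"
  assumes Y_bounded: "bounded Y" and Y_ne: "Y \<noteq> {}" and Y_dense: "dense_inv cpoly (phull Y)"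
begin

abbreviation tow :: "nat \<Rightarrow> 'n pt set" where "tow \<equiv> tower (phull Y)"

definition rexp :: "nat \<Rightarrow> 'n pexp" where "rexp k = root_exp (tow k) k"

lemma tow_Suc: "tow (Suc k) = {x \<in> tow k. (snd x k)\<^sup>2 = ev (rexp k) x}"
  by (simp add: rexp_def)

declare tower.simps(2) [simp del]

lemma rexp_vars: "j \<in> tvars (rexp k) \<Longrightarrow> j < k"
  by (auto simp: rexp_def root_exp_def Let_def legal_def split: if_splits)

lemma rexp_tpoly: "ev (rexp k) \<in> tpoly k"
  by (rule ev_tpoly) (rule rexp_vars)

lemma tow_antimono: "j \<le> k \<Longrightarrow> tow k \<subseteq> tow j"
  by (induction rule: inc_induct) (auto simp: tow_Suc)

lemma tow_fst: "x \<in> tow k \<Longrightarrow> fst x \<in> phull Y"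
  using tow_antimono[of 0 k] by auto

lemma tow_bounded_fst: "bounded (fst ` tow k)"
  by (rule bounded_subset[OF bounded_phull[OF Y_bounded Y_ne]]) (auto dest: tow_fst)

lemma tvar_bounded: "\<exists>C. \<forall>x\<in>tow (Suc k). norm (snd x k) \<le> C"
proof (induction k rule: less_induct)
  case (less k)
  have "\<exists>C. \<forall>x\<in>tow k. norm (snd x j) \<le> C" if "j < k" for j
    using less[OF that] tow_antimono[of "Suc j" k] that by (meson Suc_leI subsetD)
  then obtain C where C: "\<forall>x\<in>tow k. norm (ev (rexp k) x) \<le> C"
    using tpoly_bounded[OF rexp_tpoly tow_bounded_fst] by meson
  have "norm (snd x k) \<le> 1 + \<bar>C\<bar>" if "x \<in> tow (Suc k)" for x
  proof (rule power2_le_imp_le)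
    have "(norm (snd x k))\<^sup>2 \<le> \<bar>C\<bar>"
      using C that by (fastforce simp: tow_Suc simp flip: norm_power)
    also have "\<dots> \<le> (1 + \<bar>C\<bar>)\<^sup>2" by (simp add: power2_eq_square algebra_simps)
    finally show "(norm (snd x k))\<^sup>2 \<le> (1 + \<bar>C\<bar>)\<^sup>2" .
  qed simp
  then show ?case by blast
qed

lemma fun_algebra_tpoly: "fun_algebra (tpoly k) (tow k)"
proof unfold_locales
  fix p :: "'n pt \<Rightarrow> complex" assume "p \<in> tpoly k"
  then show "\<exists>C. \<forall>x\<in>tow k. norm (p x) \<le> C"
    by (rule tpoly_bounded[OF _ tow_bounded_fst])
      (meson tvar_bounded tow_antimono Suc_leI subsetD)
qed (simp_all add: tpoly.intros)

text \<open>The fallback expression 1 is invertible too: a code that is not legal still adjoins a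
  root, namely 1 or -1, and doubles every fiber.\<close>

lemma rexp_invertible: "invertible_in (tpoly k) (tow k) (ev (rexp k))"
proof -
  interpret fun_algebra "tpoly k" "tow k" by (rule fun_algebra_tpoly)
  have "invertible_in (tpoly k) (tow k) (ev (Cst 1 0))"
    by (rule invertible_inI[OF subsetD[OF ucl_subset_gens ev_tpoly] const_ucl[of 1]])
      (auto simp: complex_eq_iff)
  then show ?thesis by (auto simp: rexp_def root_exp_def Let_def legal_def)
qed

lemma rexp_nz: "x \<in> tow k \<Longrightarrow> ev (rexp k) x \<noteq> 0"
proof -
  interpret fun_algebra "tpoly k" "tow k" by (rule fun_algebra_tpoly)
  show "x \<in> tow k \<Longrightarrow> ev (rexp k) x \<noteq> 0"
    using rexp_invertible by (rule invertible_inE) blast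
qed

lemma tow_cong:
  assumes "x \<in> tow k" "fst x = fst y" "\<And>j. j < k \<Longrightarrow> snd x j = snd y j"
  shows "y \<in> tow k"
  using assms
proof (induction k)
  case (Suc k)
  then have "y \<in> tow k" by (simp add: tow_Suc)
  moreover have "ev (rexp k) x = ev (rexp k) y"
    by (rule tpoly_cong[OF rexp_tpoly]) (use Suc.prems in auto)
  ultimately show ?case using Suc.prems by (simp add: tow_Suc)
qed simp

text \<open>Reduction modulo \<open>t_k^2 = F_k\<close> leaves degree at most one in the last root,
  so a function on the two-sheeted cover is a pair of functions from the stage below.\<close>

lemma tpoly_Suc_split:
  assumes "p \<in> tpoly (Suc k)"
  shows "\<exists>a\<in>tpoly k. \<exists>b\<in>tpoly k. \<forall>x\<in>tow (Suc k). p x = a x + b x * snd x k"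
  using assms
proof induction
  case (const c)
  show ?case by (rule bexI[OF _ tpoly.const[of c]], rule bexI[OF _ tpoly.const[of 0]]) simp
next
  case (zvar i)
  show ?case by (rule bexI[OF _ tpoly.zvar[of i]], rule bexI[OF _ tpoly.const[of 0]]) simp
next
  case (tvar j)
  show ?case
  proof (cases "j = k")
    case True
    then show ?thesis by (intro bexI[OF _ tpoly.const[of 0]] bexI[OF _ tpoly.const[of 1]]) simp
  next
    case False
    with tvar have "j < k" by simp
    then show ?thesis by (intro bexI[OF _ tpoly.tvar[of j]] bexI[OF _ tpoly.const[of 0]]) simp_all
  qed
next
  case (add p q)
  then obtain a b a' b' where ab: "a \<in> tpoly k" "b \<in> tpoly k" "\<forall>x\<in>tow (Suc k). p x = a x + b x * snd x k"
    "a' \<in> tpoly k" "b' \<in> tpoly k" "\<forall>x\<in>tow (Suc k). q x = a' x + b' x * snd x k" by blast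
  show ?case
    by (rule bexI[OF _ tpoly.add[OF ab(1,4)]], rule bexI[OF _ tpoly.add[OF ab(2,5)]])
      (use ab(3,6) in \<open>simp add: algebra_simps\<close>)
next
  case (mult p q)
  then obtain a b a' b' where ab: "a \<in> tpoly k" "b \<in> tpoly k" "\<forall>x\<in>tow (Suc k). p x = a x + b x * snd x k"
    "a' \<in> tpoly k" "b' \<in> tpoly k" "\<forall>x\<in>tow (Suc k). q x = a' x + b' x * snd x k" by blast
  show ?case
  proof (rule bexI[OF _ tpoly.add[OF tpoly.mult[OF ab(1,4)] tpoly.mult[OF tpoly.mult[OF ab(2,5)] rexp_tpoly]]],
      rule bexI[OF _ tpoly.add[OF tpoly.mult[OF ab(1,5)] tpoly.mult[OF ab(4,2)]]], safe)
    fix z t assume x: "(z, t) \<in> tow (Suc k)"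
    then have "t k * t k = ev (rexp k) (z, t)" by (simp add: tow_Suc power2_eq_square)
    then show "p (z, t) * q (z, t) = a (z, t) * a' (z, t) + b (z, t) * b' (z, t) * ev (rexp k) (z, t)
       + (a (z, t) * b' (z, t) + a' (z, t) * b (z, t)) * snd (z, t) k"
      using ab(3,6) x by (simp add: algebra_simps)
  qed
qed

lemma ucl_tpoly_mono:
  assumes "j \<le> k" "f \<in> ucl (tpoly j) (tow j)"
  shows "f \<in> ucl (tpoly k) (tow k)"
  by (rule ucl_subset[OF _ tow_antimono[OF assms(1)] assms(2)])
    (use tpoly_mono[OF _ assms(1)] ucl_subset_gens in blast)

text \<open>The product of \<open>a + b t\<close> and its conjugate \<open>a - b t\<close> is the
  norm \<open>a^2 - b^2 F\<close>, a function of the stage below. After a small change of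
  \<open>b\<close> the norm is invertible, and conjugate over norm is the inverse.\<close>

lemma dense_inv_tow: "dense_inv (tpoly k) (tow k)"
proof (induction k)
  case 0
  interpret fun_algebra "tpoly 0" "tow 0" by (rule fun_algebra_tpoly)
  have lift: "(\<lambda>x. f (fst x)) \<in> ucl (tpoly 0) (tow 0)" if f: "f \<in> ucl cpoly (phull Y)" for f
    unfolding ucl_def
  proof safe
    fix e :: real assume "e > 0"
    then obtain p where p: "p \<in> cpoly" "\<And>x. x \<in> phull Y \<Longrightarrow> norm (f x - p x) < e"
      using uclD[OF f] by blast
    show "\<exists>q\<in>tpoly 0. \<forall>x\<in>tow 0. norm (f (fst x) - q x) < e"
      by (rule bexI[OF _ cpoly_tpoly[OF p(1)]]) (simp add: p(2))
  qed
  show ?case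
  proof (rule dense_invI)
    fix p :: "'n pt \<Rightarrow> complex" and e :: real assume "p \<in> tpoly 0" and e: "e > 0"
    then obtain q where q: "q \<in> cpoly" "p = (\<lambda>x. q (fst x))" using tpoly_0 by blast
    obtain g where g: "invertible_in cpoly (phull Y) g" "\<forall>x\<in>phull Y. norm (q x - g x) < e"
      using Y_dense[unfolded dense_inv_def] subsetD[OF ucl_subset_gens q(1)] e by blast
    then obtain h where h: "h \<in> ucl cpoly (phull Y)" "\<forall>x\<in>phull Y. g x * h x = 1" and gu: "g \<in> ucl cpoly (phull Y)"
      by (auto simp: invertible_in_def)
    have "invertible_in (tpoly 0) (tow 0) (\<lambda>x. g (fst x))"
      by (rule invertible_inI[OF lift[OF gu] lift[OF h(1)]]) (simp add: h(2))
    then show "\<exists>g. invertible_in (tpoly 0) (tow 0) g \<and> (\<forall>x\<in>tow 0. norm (p x - g x) < e)"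
      by (intro exI[of _ "\<lambda>x. g (fst x)"] conjI) (simp_all add: q(2) g(2))
  qed
next
  case (Suc k)
  interpret A: fun_algebra "tpoly k" "tow k" by (rule fun_algebra_tpoly)
  interpret B: fun_algebra "tpoly (Suc k)" "tow (Suc k)" by (rule fun_algebra_tpoly)
  note up = ucl_tpoly_mono[of k "Suc k", OF le_SucI[OF order.refl]]
  show ?case
  proof (rule dense_invI)
    fix p :: "'n pt \<Rightarrow> complex" and e :: real assume p: "p \<in> tpoly (Suc k)" and e: "e > 0"
    obtain a b where ab: "a \<in> tpoly k" "b \<in> tpoly k" "\<forall>x\<in>tow (Suc k). p x = a x + b x * snd x k"
      using tpoly_Suc_split[OF p] by blast
    have tu: "(\<lambda>x. snd x k) \<in> ucl (tpoly (Suc k)) (tow (Suc k))"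
      by (rule subsetD[OF ucl_subset_gens tpoly.tvar]) simp
    obtain T where T: "T > 0" "\<And>x. x \<in> tow (Suc k) \<Longrightarrow> norm (snd x k) \<le> T"
      using B.bounded_ucl[OF tu] by blast
    have au: "a \<in> ucl (tpoly k) (tow k)" and bu: "b \<in> ucl (tpoly k) (tow k)"
      using ab subsetD[OF ucl_subset_gens] by blast+
    have eT: "e / T > 0" using e T by simp
    obtain b' where b': "b' \<in> ucl (tpoly k) (tow k)" "\<And>x. x \<in> tow k \<Longrightarrow> norm (b x - b' x) < e / T"
      and inv: "invertible_in (tpoly k) (tow k) (\<lambda>x. (a x)\<^sup>2 - (b' x)\<^sup>2 * ev (rexp k) x)"
      by (rule norm_form_perturb[OF fun_algebra_tpoly Suc au bu rexp_invertible eT]) blast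
    define h where "h = (\<lambda>x. (a x)\<^sup>2 - (b' x)\<^sup>2 * ev (rexp k) x)"
    have hi: "(\<lambda>x. 1 / h x) \<in> ucl (tpoly k) (tow k)" and hnz: "\<And>x. x \<in> tow k \<Longrightarrow> h x \<noteq> 0"
      using A.invertible_inE[OF inv] unfolding h_def by blast+
    have "invertible_in (tpoly (Suc k)) (tow (Suc k)) (\<lambda>x. a x + b' x * snd x k)"
    proof (rule B.invertible_inI)
      show "(\<lambda>x. a x + b' x * snd x k) \<in> ucl (tpoly (Suc k)) (tow (Suc k))"
        by (intro B.add_ucl B.mult_ucl tu up[OF au] up[OF b'(1)])
      show "(\<lambda>x. (a x - b' x * snd x k) * (1 / h x)) \<in> ucl (tpoly (Suc k)) (tow (Suc k))"
        by (intro B.diff_ucl B.mult_ucl tu up[OF au] up[OF b'(1)] up[OF hi])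
      fix x assume x: "x \<in> tow (Suc k)"
      then have t: "snd x k * snd x k = ev (rexp k) x" and nz: "h x \<noteq> 0"
        using hnz by (auto simp: tow_Suc power2_eq_square)
      have "(a x + b' x * snd x k) * (a x - b' x * snd x k) = (a x)\<^sup>2 - (b' x)\<^sup>2 * (snd x k * snd x k)"
        by (simp add: algebra_simps power2_eq_square)
      then have "(a x + b' x * snd x k) * (a x - b' x * snd x k) = h x"
        unfolding t h_def .
      then show "(a x + b' x * snd x k) * ((a x - b' x * snd x k) * (1 / h x)) = 1"
        using nz by (simp add: divide_simps)
    qed
    moreover have "norm (p x - (a x + b' x * snd x k)) < e" if x: "x \<in> tow (Suc k)" for x
    proof -
      have xk: "x \<in> tow k" using x by (simp add: tow_Suc)
      have "p x - (a x + b' x * snd x k) = (b x - b' x) * snd x k"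
        using ab(3) x by (simp add: algebra_simps)
      then have "norm (p x - (a x + b' x * snd x k)) = norm (b x - b' x) * norm (snd x k)"
        by (simp add: norm_mult)
      also have "\<dots> \<le> norm (b x - b' x) * T" by (intro mult_left_mono T(2) x) simp
      also have "\<dots> < e" using b'(2)[OF xk] T(1) by (simp add: field_simps)
      finally show ?thesis .
    qed
    ultimately show "\<exists>g. invertible_in (tpoly (Suc k)) (tow (Suc k)) g \<and> (\<forall>x\<in>tow (Suc k). norm (p x - g x) < e)"
      by (intro exI[of _ "\<lambda>x. a x + b' x * snd x k"]) auto
  qed
qed

text \<open>Half the trace of each power \<open>p^n\<close> and the norm of \<open>p\<close> lie in
  \<open>tpoly k\<close> and are bounded over \<open>Y\<close> by \<open>C^n\<close> and
  \<open>C^2\<close>. Induction spreads these bounds to all points, and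
  \<open>power_sum_bound\<close> turns them back into a bound for \<open>p\<close>. All powers enter
  because the two conjugate values may cancel in a single trace.\<close>

lemma tow_max_modulus:
  assumes "p \<in> tpoly k" "\<And>x. x \<in> tow k \<Longrightarrow> fst x \<in> Y \<Longrightarrow> norm (p x) \<le> C" "x \<in> tow k"
  shows "norm (p x) \<le> C"
  using assms
proof (induction k arbitrary: p C x)
  case 0
  obtain q where q: "q \<in> cpoly" "p = (\<lambda>x. q (fst x))" using tpoly_0[OF 0(1)] by blast
  have "norm (q y) \<le> C" if "y \<in> Y" for y
    using 0(2)[of "(y, undefined)"] that subset_phull[OF Y_bounded] by (auto simp: q(2))
  moreover have "fst x \<in> phull Y" using 0(3) by simp
  ultimately show ?case using phullD[OF _ Y_ne q(1)] by (simp add: q(2))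
next
  case (Suc k)
  \<comment> \<open>The deck transformation of the last two-sheeted cover.\<close>
  define neg where "neg = (\<lambda>x::'n pt. (fst x, (snd x)(k := - snd x k)))"
  have neg_cong: "q (neg x) = q x" if "q \<in> tpoly k" for q x
    by (rule tpoly_cong[OF that]) (auto simp: neg_def)
  have neg_tow: "neg x \<in> tow (Suc k)" if x: "x \<in> tow (Suc k)" for x
  proof -
    have xk: "x \<in> tow k" and tx: "(snd x k)\<^sup>2 = ev (rexp k) x" using x by (auto simp: tow_Suc)
    have "neg x \<in> tow k" by (rule tow_cong[OF xk]) (auto simp: neg_def)
    moreover have "(snd (neg x) k)\<^sup>2 = ev (rexp k) (neg x)"
      unfolding neg_cong[OF rexp_tpoly] tx[symmetric] by (simp add: neg_def)
    ultimately show ?thesis by (simp add: tow_Suc)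
  qed
  \<comment> \<open>For a function that does not see the last root, bounds over \<open>Y\<close> at
    stage \<open>Suc k\<close> are bounds at stage \<open>k\<close>, since every point lifts;
    \<open>csqrt\<close> supplies the lift.\<close>
  have down: "norm (a x) \<le> D"
    if a: "a \<in> tpoly k" and D: "\<And>x. x \<in> tow (Suc k) \<Longrightarrow> fst x \<in> Y \<Longrightarrow> norm (a x) \<le> D" and x: "x \<in> tow (Suc k)"
    for a D x
  proof (rule Suc.IH[OF a])
    show "x \<in> tow k" using x by (simp add: tow_Suc)
    fix y assume y: "y \<in> tow k" "fst y \<in> Y"
    define y' where "y' = (fst y, (snd y)(k := csqrt (ev (rexp k) y)))"
    have yk: "y' \<in> tow k" by (rule tow_cong[OF y(1)]) (auto simp: y'_def)
    have "ev (rexp k) y' = ev (rexp k) y" by (rule tpoly_cong[OF rexp_tpoly]) (auto simp: y'_def)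
    then have "(snd y' k)\<^sup>2 = ev (rexp k) y'" by (simp add: y'_def)
    with yk have "y' \<in> tow (Suc k)" by (simp add: tow_Suc)
    then have "norm (a y') \<le> D" using D y(2) by (simp add: y'_def)
    moreover have "a y' = a y" by (rule tpoly_cong[OF a]) (auto simp: y'_def)
    ultimately show "norm (a y) \<le> D" by simp
  qed
  have nY: "fst (neg x) = fst x" for x by (simp add: neg_def)
  \<comment> \<open>If no point lay over \<open>Y\<close>, the constant 1 would be bounded by 0.
    Such a point makes \<open>C\<close> nonnegative.\<close>
  obtain y where y: "y \<in> tow (Suc k)" "fst y \<in> Y"
  proof (rule ccontr)
    assume "\<not> thesis"
    then have no: "\<And>x. x \<in> tow (Suc k) \<Longrightarrow> fst x \<notin> Y" using that by blast
    have "norm ((\<lambda>x. 1::complex) x) \<le> 0"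
      by (rule down[OF tpoly.const _ Suc.prems(3)]) (use no in blast)
    then show False by simp
  qed
  have C0: "C \<ge> 0" using Suc.prems(2)[OF y] norm_ge_zero order_trans by blast
  interpret B: fun_algebra "tpoly (Suc k)" "tow (Suc k)" by (rule fun_algebra_tpoly)
  show ?case
  proof (rule power_sum_bound[OF _ _ C0])
    fix n
    have pn: "(\<lambda>x. p x ^ n) \<in> tpoly (Suc k)" by (rule B.power_gen[OF Suc.prems(1)])
    obtain a b where ab: "a \<in> tpoly k" "b \<in> tpoly k" "\<forall>x\<in>tow (Suc k). p x ^ n = a x + b x * snd x k"
      using tpoly_Suc_split[OF pn] by blast
    have tr: "p x ^ n + p (neg x) ^ n = 2 * a x" if x: "x \<in> tow (Suc k)" for x
      using ab(3) x neg_tow[OF x] by (simp add: neg_cong[OF ab(1)] neg_cong[OF ab(2)]) (simp add: neg_def)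
    have "norm (a x) \<le> C ^ n"
    proof (rule down[OF ab(1) _ Suc.prems(3)])
      fix x assume x: "x \<in> tow (Suc k)" "fst x \<in> Y"
      have "norm (2 * a x) \<le> norm (p x) ^ n + norm (p (neg x)) ^ n"
        unfolding tr[OF x(1), symmetric] norm_power[symmetric] by (rule norm_triangle_ineq)
      also have "\<dots> \<le> C ^ n + C ^ n"
        by (intro add_mono power_mono Suc.prems(2) neg_tow x) (use x in \<open>auto simp: nY\<close>)
      finally show "norm (a x) \<le> C ^ n" by (simp add: norm_mult)
    qed
    then show "norm (p x ^ n + p (neg x) ^ n) \<le> 2 * C ^ n"
      unfolding tr[OF Suc.prems(3)] by (simp add: norm_mult)
  next
    obtain a b where ab: "a \<in> tpoly k" "b \<in> tpoly k" "\<forall>x\<in>tow (Suc k). p x = a x + b x * snd x k"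
      using tpoly_Suc_split[OF Suc.prems(1)] by blast
    let ?n = "\<lambda>x. a x * a x + (- 1) * (b x * b x * ev (rexp k) x)"
    have nt: "?n \<in> tpoly k" by (intro tpoly.add tpoly.mult tpoly.const ab rexp_tpoly)
    have nm: "p x * p (neg x) = ?n x" if x: "x \<in> tow (Suc k)" for x
    proof -
      have t: "snd x k * snd x k = ev (rexp k) x" using x by (simp add: tow_Suc power2_eq_square)
      have "p (neg x) = a x - b x * snd x k"
        using ab(3) neg_tow[OF x] by (simp add: neg_cong[OF ab(1)] neg_cong[OF ab(2)]) (simp add: neg_def)
      then have "p x * p (neg x) = (a x + b x * snd x k) * (a x - b x * snd x k)" using ab(3) x by simp
      also have "\<dots> = ?n x" unfolding t[symmetric] by (simp add: algebra_simps)
      finally show ?thesis .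
    qed
    have "norm (?n x) \<le> C\<^sup>2"
    proof (rule down[OF nt _ Suc.prems(3)])
      fix x assume x: "x \<in> tow (Suc k)" "fst x \<in> Y"
      show "norm (?n x) \<le> C\<^sup>2"
        unfolding nm[OF x(1), symmetric] norm_mult power2_eq_square
        by (intro mult_mono Suc.prems(2) neg_tow x C0) (use x in \<open>auto simp: nY\<close>)
    qed
    then show "norm (p x * p (neg x)) \<le> C\<^sup>2" unfolding nm[OF Suc.prems(3)] .
  qed
qed

section \<open>Branches and the limit of the tower\<close>

primrec br :: "complex^'n \<Rightarrow> (nat \<Rightarrow> bool) \<Rightarrow> nat \<Rightarrow> nat \<Rightarrow> complex" where
  "br z a 0 = (\<lambda>_. 0)"
| "br z a (Suc k) = (br z a k)(k := (if a k then 1 else - 1) * csqrt (ev (rexp k) (z, br z a k)))"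

text \<open>Coordinate \<open>k\<close> is written at step \<open>Suc k\<close> and never changed
  afterwards, so this is the limit of the sequences \<open>br z a k\<close>. The bit
  \<open>a k\<close> gives the sign relative to the principal root; no continuity in
  \<open>z\<close> is claimed, as fibers are studied one at a time.\<close>

definition branch :: "complex^'n \<Rightarrow> (nat \<Rightarrow> bool) \<Rightarrow> nat \<Rightarrow> complex" where
  "branch z a k = br z a (Suc k) k"

lemma br_eq_branch: "j < k \<Longrightarrow> br z a k j = branch z a j"
  by (induction k) (auto simp: branch_def less_Suc_eq)

lemma branch_rec: "branch z a k = (if a k then 1 else - 1) * csqrt (ev (rexp k) (z, branch z a))"
proof -
  have "ev (rexp k) (z, br z a k) = ev (rexp k) (z, branch z a)"
    by (rule tpoly_cong[OF rexp_tpoly]) (auto simp: br_eq_branch)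
  then show ?thesis by (simp add: branch_def[of z a k])
qed

definition ltow :: "'n pt set" where "ltow = (\<Inter>k. tow k)"

lemma ltow_tow: "ltow \<subseteq> tow k" by (auto simp: ltow_def)

lemma ltow_fst: "x \<in> ltow \<Longrightarrow> fst x \<in> phull Y"
  using ltow_tow[of 0] by auto

lemma branch_ltow: 
  assumes "z \<in> phull Y" 
  shows "(z, branch z a) \<in> ltow"
proof -
  have "(z, branch z a) \<in> tow k" for k
  proof (induction k)
    case (Suc k)
    have "(branch z a k)\<^sup>2 = ev (rexp k) (z, branch z a)"
      unfolding branch_rec[of z a k] by (simp add: power_mult_distrib)
    with Suc show ?case by (simp add: tow_Suc)
  qed (use assms in simp)
  then show ?thesis by (simp add: ltow_def)
qed

lemma branch_eqI:
  assumes "\<And>j. j < n \<Longrightarrow> a j = b j" "j < n"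
  shows "branch z a j = branch z b j"
  using assms(2)
proof (induction j rule: less_induct)
  case (less j)
  have "ev (rexp j) (z, branch z a) = ev (rexp j) (z, branch z b)"
    by (rule tpoly_cong[OF rexp_tpoly]) (use less in auto)
  then show ?case using assms(1)[OF less.prems] by (simp add: branch_rec[of _ _ j])
qed

text \<open>Each coordinate is one of two opposite roots, and the bit records whether it is the
  principal one. With \<open>branch_ltow\<close> this parametrizes every fiber by bit
  sequences.\<close>

lemma tow_branch:
  assumes "x \<in> tow k" "j < k"
  shows "snd x j = branch (fst x) (\<lambda>j. snd x j = csqrt (ev (rexp j) x)) j" (is "_ = branch _ ?a _")
  using assms(2)
proof (induction j rule: less_induct)
  case (less j)
  have "ev (rexp j) (fst x, branch (fst x) ?a) = ev (rexp j) x"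
    by (rule tpoly_cong[OF rexp_tpoly]) (use less in auto)
  moreover have "x \<in> tow (Suc j)" using less.prems tow_antimono[of "Suc j" k] assms by auto
  then have "(snd x j)\<^sup>2 = (csqrt (ev (rexp j) x))\<^sup>2" by (simp add: tow_Suc)
  then have "snd x j = csqrt (ev (rexp j) x) \<or> snd x j = - csqrt (ev (rexp j) x)"
    using power2_eq_iff by blast
  ultimately show ?case by (auto simp: branch_rec[of _ _ j] simp del: csqrt.sel)
qed

lemma ltow_branch:
  assumes "x \<in> ltow"
  obtains a where "x = (fst x, branch (fst x) a)"
proof (rule that)
  have *: "snd x j = branch (fst x) (\<lambda>j. snd x j = csqrt (ev (rexp j) x)) j" for j
    by (rule tow_branch[of _ "Suc j"]) (use assms ltow_tow in auto)
  show "x = (fst x, branch (fst x) (\<lambda>j. snd x j = csqrt (ev (rexp j) x)))"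
    by (rule prod_eqI) (use * in \<open>unfold fst_conv snd_conv, blast+\<close>)
qed

text \<open>Surjectivity of the limit onto the first \<open>k\<close> roots, used to read a bound on
  the limit as a bound on a stage.\<close>

lemma tow_extend:
  assumes "x \<in> tow k"
  obtains y where "y \<in> ltow" "fst y = fst x" "\<And>j. j < k \<Longrightarrow> snd y j = snd x j"
proof (rule that)
  let ?y = "(fst x, branch (fst x) (\<lambda>j. snd x j = csqrt (ev (rexp j) x)))"
  show "?y \<in> ltow" by (rule branch_ltow) (rule tow_fst[OF assms])
  show "fst ?y = fst x" by simp
  show "snd ?y j = snd x j" if "j < k" for j
    unfolding snd_conv by (rule tow_branch[OF assms that, symmetric])
qed

end

subsection \<open>Encoding all roots in one coordinate\<close>

context sqrt_tower
begin

section \<open>Bounds for the roots and the choice of weights\<close>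

lemma tvar_bounds: "\<exists>b m. 0 < m \<and> m \<le> 1 \<and> 1 \<le> b \<and> (\<forall>x\<in>tow (Suc k). m \<le> norm (snd x k) \<and> norm (snd x k) \<le> b)"
proof -
  interpret fun_algebra "tpoly k" "tow k" by (rule fun_algebra_tpoly)
  obtain C where C: "\<forall>x\<in>tow (Suc k). norm (snd x k) \<le> C" using tvar_bounded by blast
  obtain inv: "(\<lambda>x. 1 / ev (rexp k) x) \<in> ucl (tpoly k) (tow k)"
    using invertible_inE[OF rexp_invertible] by blast
  obtain D where D: "D > 0" "\<And>x. x \<in> tow k \<Longrightarrow> norm (1 / ev (rexp k) x) \<le> D"
    using bounded_ucl[OF inv] by blast
  \<comment> \<open>Chosen so that \<open>m^2 \<le> m \<le> 1 / D\<close>, where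
    \<open>1 / D\<close> bounds the squared modulus of the root from below.\<close>
  define m where "m = 1 / (1 + D)"
  have m: "0 < m" "m \<le> 1" using D by (auto simp: m_def)
  have "m \<le> norm (snd x k)" if x: "x \<in> tow (Suc k)" for x
  proof (rule power2_le_imp_le)
    have xk: "x \<in> tow k" and t: "(snd x k)\<^sup>2 = ev (rexp k) x" using x by (auto simp: tow_Suc)
    have "m\<^sup>2 \<le> m" using m by (simp add: power2_eq_square mult_le_one)
    also have "m \<le> 1 / D" using D by (auto simp: m_def frac_le)
    also have "1 / D \<le> norm (ev (rexp k) x)"
      using D(2)[OF xk] D(1) rexp_nz[OF xk] by (simp add: norm_divide field_simps)
    also have "\<dots> = (norm (snd x k))\<^sup>2" by (simp add: norm_power flip: t)
    finally show "m\<^sup>2 \<le> (norm (snd x k))\<^sup>2" .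
  qed simp
  moreover have "norm (snd x k) \<le> 1 + \<bar>C\<bar>" if "x \<in> tow (Suc k)" for x using C that by force
  ultimately show ?thesis using m by (intro exI[of _ "1 + \<bar>C\<bar>"] exI[of _ m]) auto
qed

definition bounds :: "nat \<Rightarrow> real \<times> real" where
  "bounds k = (SOME (b, m). 0 < m \<and> m \<le> 1 \<and> 1 \<le> b \<and> (\<forall>x\<in>tow (Suc k). m \<le> norm (snd x k) \<and> norm (snd x k) \<le> b))"

definition ub :: "nat \<Rightarrow> real" where "ub k = fst (bounds k)"
definition lb :: "nat \<Rightarrow> real" where "lb k = snd (bounds k)"

lemma ub_lb: "0 < lb k" "lb k \<le> 1" "1 \<le> ub k"
  "x \<in> tow (Suc k) \<Longrightarrow> lb k \<le> norm (snd x k)" "x \<in> tow (Suc k) \<Longrightarrow> norm (snd x k) \<le> ub k"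
proof -
  have "case bounds k of (b, m) \<Rightarrow> 0 < m \<and> m \<le> 1 \<and> 1 \<le> b \<and> (\<forall>x\<in>tow (Suc k). m \<le> norm (snd x k) \<and> norm (snd x k) \<le> b)"
    unfolding bounds_def by (rule someI_ex) (use tvar_bounds[of k] in auto)
  then show "0 < lb k" "lb k \<le> 1" "1 \<le> ub k"
  "x \<in> tow (Suc k) \<Longrightarrow> lb k \<le> norm (snd x k)" "x \<in> tow (Suc k) \<Longrightarrow> norm (snd x k) \<le> ub k"
    by (auto simp: ub_def lb_def split: prod.splits)
qed

text \<open>The weights decrease so fast that the tail of the series for \<open>w\<close> after the \<open>k\<close>-th term is at most
  a quarter of the modulus of that term.\<close>

primrec cf :: "nat \<Rightarrow> real" where
  "cf 0 = 1"
| "cf (Suc k) = cf k * (lb k / (8 * ub k))"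

text \<open>Division by \<open>ub k\<close> makes \<open>cf k\<close> a bound for the
  \<open>k\<close>-th term of the series, uniformly on the limit of the tower.\<close>

definition wgt :: "nat \<Rightarrow> real" where "wgt k = cf k / ub k"

lemma cf_pos: "0 < cf k"
proof (induction k)
  case (Suc k)
  have "0 < lb k / (8 * ub k)" using ub_lb(1,3)[of k] by simp
  with Suc show ?case unfolding cf.simps by (rule mult_pos_pos)
qed simp

lemma wgt_pos: "0 < wgt k"
  using cf_pos[of k] ub_lb(3)[of k] by (simp add: wgt_def)

lemma cf_Suc_le: "cf (Suc k) \<le> cf k / 8"
proof -
  have "lb k / (8 * ub k) \<le> 1 / (8 * 1)" by (rule frac_le) (use ub_lb(1-3)[of k] in auto)
  from mult_left_mono[OF this less_imp_le[OF cf_pos[of k]]] show ?thesis by simp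
qed

lemma cf_add_le: "cf (i + n) \<le> cf n * (1/8) ^ i"
proof (induction i)
  case (Suc i)
  then show ?case using cf_Suc_le[of "i + n"] by simp
qed simp

lemma summable_cf: "summable cf"
proof (rule summable_comparison_test)
  show "\<exists>N. \<forall>n\<ge>N. norm (cf n) \<le> (1/8) ^ n"
    using cf_add_le[of _ 0] cf_pos by (auto intro!: exI[of _ 0] simp: abs_of_pos)
qed (simp add: summable_geometric)

lemma cf_tail: "(\<Sum>i. cf (i + n)) \<le> 8/7 * cf n"
proof -
  have "(\<Sum>i. cf (i + n)) \<le> (\<Sum>i. cf n * (1/8) ^ i)"
    by (rule suminf_le) (use cf_add_le summable_cf summable_mult[OF summable_geometric[of "1/8::real"]] in \<open>auto simp: summable_iff_shift\<close>)
  also have "\<dots> = cf n * (8/7)" by (simp add: suminf_mult suminf_geometric summable_geometric)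
  finally show ?thesis by simp
qed

definition wsum :: "(nat \<Rightarrow> complex) \<Rightarrow> complex" where "wsum t = (\<Sum>k. of_real (wgt k) * t k)"

lemma wgt_term_le: "x \<in> ltow \<Longrightarrow> norm (of_real (wgt k) * snd x k) \<le> cf k"
proof -
  assume "x \<in> ltow"
  then have "norm (snd x k) \<le> ub k" using ub_lb(5) ltow_tow by blast
  then have "wgt k * norm (snd x k) \<le> wgt k * ub k" using wgt_pos[of k] by simp
  also have "\<dots> = cf k" using ub_lb(3)[of k] by (simp add: wgt_def)
  finally show ?thesis using wgt_pos[of k] by (simp add: norm_mult)
qed

lemma wsum_tail:
  assumes "x \<in> ltow"
  shows "norm (wsum (snd x) - (\<Sum>j<n. of_real (wgt j) * snd x j)) \<le> 8/7 * cf n"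
proof -
  have sm: "summable (\<lambda>k. of_real (wgt k) * snd x k)"
    by (rule summable_comparison_test'[OF summable_cf, of 0]) (rule wgt_term_le[OF assms])
  have sc: "summable (\<lambda>i. cf (i + n))" using summable_cf by (simp add: summable_iff_shift)
  have "wsum (snd x) - (\<Sum>j<n. of_real (wgt j) * snd x j) = (\<Sum>i. of_real (wgt (i + n)) * snd x (i + n))"
    unfolding wsum_def by (subst suminf_split_initial_segment[OF sm, of n]) simp
  also have "norm \<dots> \<le> (\<Sum>i. cf (i + n))"
    by (rule norm_suminf_le[OF wgt_term_le[OF assms] sc])
  also have "\<dots> \<le> 8/7 * cf n" by (rule cf_tail)
  finally show ?thesis .
qed

lemma wsum_tail_Suc:
  assumes "x \<in> ltow"
  shows "norm (wsum (snd x) - (\<Sum>j<Suc k. of_real (wgt j) * snd x j)) \<le> wgt k * lb k / 4"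
proof -
  \<comment> \<open>The tail constant 8/7 is rounded up to 2 because \<open>2 * cf (Suc k)\<close>
    is exactly \<open>wgt k * lb k / 4\<close>.\<close>
  have "8/7 * cf (Suc k) \<le> 2 * cf (Suc k)" using cf_pos[of "Suc k"] by simp
  also have "\<dots> = wgt k * lb k / 4" by (simp add: wgt_def)
  finally show ?thesis using wsum_tail[OF assms, of "Suc k"] by simp
qed

section \<open>The encoding map and the recovery of the roots\<close>

definition W :: "'n pt \<Rightarrow> complex^('n option)" where
  "W x = (\<chi> i. case i of None \<Rightarrow> wsum (snd x) | Some i \<Rightarrow> fst x $ i)"

lemma W_None [simp]: "W x $ None = wsum (snd x)" and W_Some [simp]: "W x $ Some i = fst x $ i"
  by (simp_all add: W_def)

lemma proj_W [simp]: "proj (W x) = fst x"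
  by (simp add: proj_def vec_eq_iff)

lemma tpoly_UN: "p \<in> tpoly k \<Longrightarrow> p \<in> (\<Union>k. tpoly k)"
  by blast

lemma fun_algebra_UN_tpoly: "fun_algebra (\<Union>k. tpoly k) ltow"
proof unfold_locales
  fix p q :: "'n pt \<Rightarrow> complex" assume "p \<in> (\<Union>k. tpoly k)" "q \<in> (\<Union>k. tpoly k)"
  then obtain i j where "p \<in> tpoly i" "q \<in> tpoly j" by blast
  then have pq: "p \<in> tpoly (max i j)" "q \<in> tpoly (max i j)" by (auto intro: tpoly_mono)
  show "(\<lambda>x. p x + q x) \<in> (\<Union>k. tpoly k)" using tpoly.add[OF pq] by (rule tpoly_UN)
  show "(\<lambda>x. p x * q x) \<in> (\<Union>k. tpoly k)" using tpoly.mult[OF pq] by (rule tpoly_UN)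
next
  fix p :: "'n pt \<Rightarrow> complex" assume "p \<in> (\<Union>k. tpoly k)"
  then obtain i where "p \<in> tpoly i" by blast
  then have "\<exists>C. \<forall>x\<in>tow i. norm (p x) \<le> C"
    by (rule fun_algebra.bounded_gen[OF fun_algebra_tpoly])
  then show "\<exists>C. \<forall>x\<in>ltow. norm (p x) \<le> C" using ltow_tow by blast
next
  show "(\<lambda>x::'n pt. c) \<in> (\<Union>k. tpoly k)" for c by (rule tpoly_UN[OF tpoly.const])
qed

lemma wsum_ucl: "(\<lambda>x. wsum (snd x)) \<in> ucl (\<Union>k. tpoly k) ltow"
proof -
  interpret fun_algebra "\<Union>k. tpoly k" ltow by (rule fun_algebra_UN_tpoly)
  have t: "(\<lambda>x. snd x k) \<in> ucl (\<Union>k. tpoly k) ltow" for k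
    by (rule subsetD[OF ucl_subset_gens tpoly_UN[OF tpoly.tvar[OF lessI]]])
  show ?thesis unfolding wsum_def
    by (rule suminf_ucl[OF cmult_ucl[OF t] wgt_term_le summable_cf])
qed

lemma cpoly_W_ucl: "p \<in> cpoly \<Longrightarrow> (\<lambda>x. p (W x)) \<in> ucl (\<Union>k. tpoly k) ltow"
proof (induction rule: cpoly.induct)
  interpret fun_algebra "\<Union>k. tpoly k" ltow by (rule fun_algebra_UN_tpoly)
  {
    case (const c)
    show ?case by (rule const_ucl)
  next
    case (add p q)
    then show ?case by (intro add_ucl)
  next
    case (mult p q)
    then show ?case by (intro mult_ucl)
  next
    case (coord i)
    show ?case
    proof (cases i)
      case None
      then show ?thesis using wsum_ucl by simp
    next
      case (Some j)
      have "(\<lambda>x. fst x $ j) \<in> ucl (\<Union>k. tpoly k) ltow"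
        by (rule subsetD[OF ucl_subset_gens tpoly_UN[OF tpoly.zvar]])
      then show ?thesis using Some by simp
    qed
  }
qed

lemma bounded_W: "bounded (W ` ltow)"
proof -
  interpret fun_algebra "\<Union>k. tpoly k" ltow by (rule fun_algebra_UN_tpoly)
  have "\<exists>C. \<forall>x\<in>ltow. norm (W x $ i) \<le> C" for i
    using bounded_ucl[OF cpoly_W_ucl[OF cpoly.coord[of i]]] by meson
  then obtain C where C: "\<And>i x. x \<in> ltow \<Longrightarrow> norm (W x $ i) \<le> C i" by metis
  have "norm (W x) \<le> (\<Sum>i\<in>UNIV. C i)" if "x \<in> ltow" for x
  proof -
    have "norm (W x) \<le> (\<Sum>i\<in>UNIV. norm (W x $ i))" unfolding norm_vec_def by (rule L2_set_le_sum) auto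
    also have "\<dots> \<le> (\<Sum>i\<in>UNIV. C i)" by (rule sum_mono) (rule C[OF that])
    finally show ?thesis .
  qed
  then show ?thesis unfolding bounded_iff by blast
qed

text \<open>Polynomials in the encoded coordinates, pulled back to the limit of the tower. There
  they have the same uniform closure as all \<open>tpoly k\<close> together, which is why one extra
  coordinate is enough.\<close>

definition wpoly :: "('n pt \<Rightarrow> complex) set" where "wpoly = (\<lambda>p x. p (W x)) ` cpoly"

lemma fun_algebra_wpoly: "fun_algebra wpoly ltow"
proof unfold_locales
  fix p q :: "'n pt \<Rightarrow> complex" assume "p \<in> wpoly" "q \<in> wpoly"
  then obtain p' q' where pq: "p' \<in> cpoly" "q' \<in> cpoly" and "p = (\<lambda>x. p' (W x))" "q = (\<lambda>x. q' (W x))"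
    unfolding wpoly_def by blast
  then show "(\<lambda>x. p x + q x) \<in> wpoly" "(\<lambda>x. p x * q x) \<in> wpoly"
    unfolding wpoly_def
    by (simp_all add: image_eqI[OF _ cpoly.add[OF pq]] image_eqI[OF _ cpoly.mult[OF pq]])
next
  fix p :: "'n pt \<Rightarrow> complex" assume "p \<in> wpoly"
  then obtain p' where p': "p' \<in> cpoly" "p = (\<lambda>x. p' (W x))" unfolding wpoly_def by blast
  show "\<exists>C. \<forall>x\<in>ltow. norm (p x) \<le> C"
    using cpoly_bounded[OF bounded_W p'(1)] by (auto simp: p'(2))
next
  show "(\<lambda>x::'n pt. c) \<in> wpoly" for c unfolding wpoly_def by (rule image_eqI[OF _ cpoly.const]) simp
qed

lemma tpoly_ucl_wpoly:
  assumes t: "\<And>j. j < k \<Longrightarrow> (\<lambda>x. snd x j) \<in> ucl wpoly ltow" and p: "p \<in> tpoly k"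
  shows "p \<in> ucl wpoly ltow"
  using p
proof induction
  interpret fun_algebra wpoly ltow by (rule fun_algebra_wpoly)
  {
    case (const c)
    show ?case by (rule const_ucl)
  next
    case (zvar i)
    have "(\<lambda>x. fst x $ i) \<in> wpoly"
      unfolding wpoly_def by (rule image_eqI[OF _ cpoly.coord[of "Some i"]]) simp
    then show ?case by (rule subsetD[OF ucl_subset_gens])
  next
    case (tvar j)
    then show ?case by (rule t)
  next
    case (add p q)
    then show ?case by (intro add_ucl)
  next
    case (mult p q)
    then show ?case by (intro mult_ucl)
  }
qed

text \<open>\<open>v = (w - \<Sum>j<k. wgt j * t j) / wgt k\<close> is so close to \<open>t k\<close> that \<open>v\<^sup>2 / (t k)\<^sup>2\<close> has a square root near 1.\<close>

lemma tvar_ucl_wpoly: "(\<lambda>x. snd x k) \<in> ucl wpoly ltow"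
proof (induction k rule: less_induct)
  case (less k)
  interpret fun_algebra wpoly ltow by (rule fun_algebra_wpoly)
  have "(\<lambda>x. wsum (snd x)) \<in> wpoly"
    unfolding wpoly_def by (rule image_eqI[OF _ cpoly.coord[of None]]) simp
  then have wu: "(\<lambda>x. wsum (snd x)) \<in> ucl wpoly ltow" by (rule subsetD[OF ucl_subset_gens])
  define v where "v = (\<lambda>x::'n pt. of_real (1 / wgt k) * (wsum (snd x) - (\<Sum>j<k. of_real (wgt j) * snd x j)))"
  have vu: "v \<in> ucl wpoly ltow" unfolding v_def
    by (intro cmult_ucl diff_ucl wu sum_ucl) (use less in auto)
  have vt: "norm (v x - snd x k) \<le> lb k / 4" if x: "x \<in> ltow" for x
  proof -
    have "v x - snd x k = of_real (1 / wgt k) * (wsum (snd x) - (\<Sum>j<Suc k. of_real (wgt j) * snd x j))"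
      using wgt_pos[of k] by (simp add: v_def field_simps)
    then have "norm (v x - snd x k) = (1 / wgt k) * norm (wsum (snd x) - (\<Sum>j<Suc k. of_real (wgt j) * snd x j))"
      using wgt_pos[of k] by (simp add: norm_divide)
    also have "\<dots> \<le> (1 / wgt k) * (wgt k * lb k / 4)"
      by (intro mult_left_mono wsum_tail_Suc[OF x]) (use wgt_pos[of k] in simp)
    also have "\<dots> = lb k / 4" using wgt_pos[of k] by simp
    finally show ?thesis .
  qed
  \<comment> \<open>The radicand involves earlier roots only, which by induction are limits of
    polynomials in \<open>(z, w)\<close>; hence so is its inverse, which comes from stage
    \<open>k\<close>.\<close>
  have inv: "invertible_in wpoly ltow (ev (rexp k))"
    by (rule invertible_in_transfer[OF _ ltow_tow rexp_invertible])
      (use tpoly_ucl_wpoly less in blast)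
  then have iu: "(\<lambda>x. 1 / ev (rexp k) x) \<in> ucl wpoly ltow" by (rule invertible_inE) 
  define u where "u = (\<lambda>x. (v x)\<^sup>2 * (1 / ev (rexp k) x))"
  have uu: "u \<in> ucl wpoly ltow" unfolding u_def by (intro mult_ucl power_ucl vu iu)
  have near: "norm (v x / snd x k - 1) \<le> 1/4" "u x = (v x / snd x k)\<^sup>2" "snd x k \<noteq> 0" if x: "x \<in> ltow" for x
  proof -
    have xk: "x \<in> tow (Suc k)" using x ltow_tow by blast
    have l: "lb k \<le> norm (snd x k)" by (rule ub_lb(4)[OF xk])
    then show nz: "snd x k \<noteq> 0" using ub_lb(1)[of k] by auto
    have "v x / snd x k - 1 = (v x - snd x k) / snd x k" using nz by (simp add: field_simps)
    then have "norm (v x / snd x k - 1) = norm (v x - snd x k) / norm (snd x k)" by (simp add: norm_divide)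
    also have "\<dots> \<le> (lb k / 4) / lb k"
      by (rule frac_le) (use vt[OF x] l ub_lb(1)[of k] in auto)
    finally show "norm (v x / snd x k - 1) \<le> 1/4" using ub_lb(1)[of k] by simp
    have "(snd x k)\<^sup>2 = ev (rexp k) x" using xk by (simp add: tow_Suc)
    then show "u x = (v x / snd x k)\<^sup>2" by (simp add: u_def power_divide)
  qed
  have u1: "norm (u x - 1) \<le> 9/16" if x: "x \<in> ltow" for x
  proof -
    let ?r = "v x / snd x k"
    have "u x - 1 = (?r - 1) * (2 + (?r - 1))"
      unfolding near(2)[OF x] by (simp add: algebra_simps power2_eq_square)
    then have "norm (u x - 1) = norm (?r - 1) * norm (2 + (?r - 1))" by (simp add: norm_mult)
    also have "\<dots> \<le> 1/4 * (2 + 1/4)"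
      by (intro mult_mono near(1)[OF x] norm_triangle_le add_mono) auto
    finally show ?thesis by simp
  qed
  have gu: "(\<lambda>x. u x powr (-1/2)) \<in> ucl wpoly ltow"
    by (rule powr_ucl[OF uu _ u1]) simp
  have "(\<lambda>x. v x * u x powr (-1/2)) \<in> ucl wpoly ltow" by (rule mult_ucl[OF vu gu])
  then show ?case
  proof (rule ucl_cong)
    fix x assume x: "x \<in> ltow"
    let ?r = "v x / snd x k"
    \<comment> \<open>Of the two roots of \<open>u x\<close>, the principal one is
      \<open>?r\<close>, because \<open>?r\<close> lies in the right half plane. Dividing
      \<open>v x\<close> by it returns the root with the correct sign.\<close>
    have "\<bar>Re (?r - 1)\<bar> \<le> 1/4" using abs_Re_le_cmod[of "?r - 1"] near(1)[OF x] by linarith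
    then have "\<bar>Re ?r - 1\<bar> \<le> 1/4" by (simp only: minus_complex.sel one_complex.sel)
    then have re: "Re ?r > 0" by linarith
    have "csqrt (u x) = ?r" by (rule csqrt_unique) (use near(2)[OF x] re in auto)
    then have "u x powr (-1/2) = 1 / ?r"
      using powr_minus_divide[of "u x" "1/2"] by (simp add: csqrt_conv_powr)
    moreover have "?r \<noteq> 0" using re by auto
    ultimately show "v x * u x powr (-1/2) = snd x k" using near(3)[OF x] by (simp add: field_simps)
  qed
qed

lemma UN_tpoly_ucl_wpoly: "(\<Union>k. tpoly k) \<subseteq> ucl wpoly ltow"
  using tpoly_ucl_wpoly tvar_ucl_wpoly by blast

lemma wpoly_ucl_UN_tpoly: "wpoly \<subseteq> ucl (\<Union>k. tpoly k) ltow"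
  unfolding wpoly_def using cpoly_W_ucl by auto

text \<open>A polynomial in the encoded coordinates is nearly a function of finitely many roots, and
  density of invertibles is known at that stage. The approximant is invertible on all of
  \<open>tow k\<close> and not just on the limit, as legality demands.\<close>

lemma wpoly_invertible_approx:
  assumes "f \<in> ucl wpoly ltow" "e > 0"
  obtains k p where "p \<in> tpoly k" "invertible_in (tpoly k) (tow k) p" "\<And>x. x \<in> ltow \<Longrightarrow> norm (f x - p x) < e"
proof -
  have "f \<in> ucl (\<Union>k. tpoly k) ltow"
    by (rule ucl_subset[OF wpoly_ucl_UN_tpoly order.refl assms(1)])
  then obtain q where q: "q \<in> (\<Union>k. tpoly k)" "\<And>x. x \<in> ltow \<Longrightarrow> norm (f x - q x) < e/2"
    using uclD[of f _ _ "e/2"] assms(2) by (metis half_gt_zero)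
  then obtain k where k: "q \<in> tpoly k" by blast
  have e2: "e/2 > 0" using assms(2) by simp
  obtain p where p: "p \<in> tpoly k" "invertible_in (tpoly k) (tow k) p" "\<And>x. x \<in> tow k \<Longrightarrow> norm (q x - p x) < e/2"
    by (rule dense_inv_approx[OF fun_algebra_tpoly dense_inv_tow subsetD[OF ucl_subset_gens k] e2]) blast
  show ?thesis
  proof (rule that[OF p(1,2)])
    fix x assume x: "x \<in> ltow"
    then have "x \<in> tow k" using ltow_tow by blast
    then show "norm (f x - p x) < e"
      using q(2)[OF x] p(3) norm_diff_triangle_less[of "f x" "q x" "e/2" "p x" "e/2"] by auto
  qed
qed

lemma dense_inv_wpoly: "dense_inv wpoly ltow"
proof (rule dense_invI)
  fix p :: "'n pt \<Rightarrow> complex" and e :: real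
  assume p: "p \<in> wpoly" and e: "e > 0"
  obtain k q where q: "q \<in> tpoly k" "invertible_in (tpoly k) (tow k) q" "\<And>x. x \<in> ltow \<Longrightarrow> norm (p x - q x) < e"
    by (rule wpoly_invertible_approx[OF subsetD[OF ucl_subset_gens p] e]) blast
  have "invertible_in wpoly ltow q"
    by (rule invertible_in_transfer[OF _ ltow_tow q(2)]) (use UN_tpoly_ucl_wpoly in blast)
  with q(3) show "\<exists>g. invertible_in wpoly ltow g \<and> (\<forall>x\<in>ltow. norm (p x - g x) < e)" by blast
qed

lemma dense_squares_wpoly:
  assumes f: "f \<in> ucl wpoly ltow" and e: "e > 0"
  obtains k where "\<And>x. x \<in> ltow \<Longrightarrow> norm (f x - (snd x k)\<^sup>2) < e"
proof -
  have e2: "e/2 > 0" using e by simp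
  obtain k p where p: "p \<in> tpoly k" "invertible_in (tpoly k) (tow k) p" "\<And>x. x \<in> ltow \<Longrightarrow> norm (f x - p x) < e/2"
    by (rule wpoly_invertible_approx[OF f e2]) blast
  interpret fun_algebra "tpoly k" "tow k" by (rule fun_algebra_tpoly)
  obtain d where d: "d > 0" "\<And>g. g \<in> ucl (tpoly k) (tow k) \<Longrightarrow> (\<And>x. x \<in> tow k \<Longrightarrow> norm (p x - g x) < d) \<Longrightarrow> invertible_in (tpoly k) (tow k) g"
    using invertible_in_nearby[OF p(2)] by blast
  have "p \<in> ucl {ev a |a. \<forall>j\<in>tvars a. j < k} (tow k)" by (rule tpoly_approx_ev[OF fun_algebra_tpoly p(1)])
  moreover have "min d (e/2) > 0" using d(1) e by simp
  ultimately obtain a where a: "\<forall>j\<in>tvars a. j < k" "\<forall>x\<in>tow k. norm (p x - ev a x) < min d (e/2)"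
    unfolding ucl_def by blast
  have "ev a \<in> ucl (tpoly k) (tow k)" by (rule subsetD[OF ucl_subset_gens ev_tpoly]) (use a(1) in blast)
  then have inv: "invertible_in (tpoly k) (tow k) (ev a)" using d(2) a(2) by simp
  \<comment> \<open>The second component of the code ensures \<open>k \<le> n\<close>, so at stage
    \<open>n\<close> all variables of \<open>a\<close> exist and \<open>a\<close> is still
    invertible. Step \<open>n\<close> therefore adjoins precisely a root of
    \<open>a\<close>.\<close>
  define n where "n = prod_encode (to_nat a, k)"
  have kn: "k \<le> n" unfolding n_def by (rule le_prod_encode_2)
  have "invertible_in (tpoly n) (tow n) (ev a)"
    by (rule invertible_in_transfer[OF _ tow_antimono[OF kn] inv])
      (use tpoly_mono[OF _ kn] ucl_subset_gens in blast)
  then have "legal (tow n) n a" using a(1) kn by (auto simp: legal_def)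
  then have "rexp n = a" by (simp add: rexp_def root_exp_def n_def Let_def)
  show ?thesis
  proof (rule that[of n])
    fix x assume x: "x \<in> ltow"
    then have "x \<in> tow (Suc n)" "x \<in> tow k" using ltow_tow by blast+
    then have "(snd x n)\<^sup>2 = ev a x" "norm (p x - ev a x) < e/2"
      using a(2) by (auto simp: tow_Suc \<open>rexp n = a\<close>)
    then show "norm (f x - (snd x n)\<^sup>2) < e"
      using p(3)[OF x] norm_diff_triangle_less[of "f x" "p x" "e/2" "ev a x" "e/2"] by auto
  qed
qed

lemma ltow_max_modulus:
  assumes p: "p \<in> wpoly" and C: "\<And>x. x \<in> ltow \<Longrightarrow> fst x \<in> Y \<Longrightarrow> norm (p x) \<le> C" and x: "x \<in> ltow"
  shows "norm (p x) \<le> C"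
proof (rule field_le_epsilon)
  fix e :: real assume "e > 0"
  then have e2: "e/2 > 0" by simp
  have "p \<in> ucl (\<Union>k. tpoly k) ltow" using p wpoly_ucl_UN_tpoly by blast
  from uclD[OF this e2] obtain q where q: "q \<in> (\<Union>k. tpoly k)" "\<And>x. x \<in> ltow \<Longrightarrow> norm (p x - q x) < e/2" by blast
  then obtain k where k: "q \<in> tpoly k" by blast
  have "norm (q x) \<le> C + e/2"
  proof (rule tow_max_modulus[OF k])
    show "x \<in> tow k" using x ltow_tow by blast
    fix y assume y: "y \<in> tow k" "fst y \<in> Y"
    obtain y' where y': "y' \<in> ltow" "fst y' = fst y" "\<And>j. j < k \<Longrightarrow> snd y' j = snd y j"
      by (rule tow_extend[OF y(1)]) blast
    have "q y' = q y" by (rule tpoly_cong[OF k y'(2,3)])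
    then show "norm (q y) \<le> C + e/2"
      using C[OF y'(1)] q(2)[OF y'(1)] y(2) y'(2) norm_triangle_ineq2[of "q y'" "p y'"]
      by (simp add: norm_minus_commute)
  qed
  then show "norm (p x) \<le> C + e"
    using q(2)[OF x] norm_triangle_ineq2[of "p x" "q x"] by simp
qed

text \<open>At the first index where the bits differ the roots are opposite, so the partial sums are
  at least \<open>2 * wgt k * lb k\<close> apart; each of the two tails takes away at most a quarter
  of \<open>wgt k * lb k\<close>.\<close>

lemma branch_separated:
  assumes z: "z \<in> phull Y" and ab: "\<And>j. j < k \<Longrightarrow> a j = b j" "a k \<noteq> b k"
  shows "norm (wsum (branch z a) - wsum (branch z b)) \<ge> wgt k * lb k"
proof -
  let ?A = "(z, branch z a)" and ?B = "(z, branch z b)"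
  let ?s = "\<lambda>t. \<Sum>j<Suc k. of_real (wgt j) * t j :: complex"
  have tri: "norm (u - v) \<le> norm (U - u) + norm (V - v) + norm (U - V)" for u v U V :: complex
    by norm
  have eq: "branch z a j = branch z b j" if "j < k" for j by (rule branch_eqI[OF ab(1) that])
  have "ev (rexp k) ?A = ev (rexp k) ?B" by (rule tpoly_cong[OF rexp_tpoly]) (auto simp: eq)
  then have neg: "branch z b k = - branch z a k" using ab(2) by (auto simp: branch_rec[of _ _ k])
  have "?s (branch z a) - ?s (branch z b) = of_real (2 * wgt k) * branch z a k"
    using eq by (simp add: neg)
  then have "norm (?s (branch z a) - ?s (branch z b)) = norm (of_real (2 * wgt k) * branch z a k)"
    by (rule arg_cong)
  then have "norm (?s (branch z a) - ?s (branch z b)) = 2 * wgt k * norm (branch z a k)"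
    using wgt_pos[of k] unfolding norm_mult norm_of_real by simp
  moreover have "lb k \<le> norm (branch z a k)"
    using ub_lb(4)[of ?A k] branch_ltow[OF z] ltow_tow by auto
  then have "2 * wgt k * lb k \<le> 2 * wgt k * norm (branch z a k)" using wgt_pos[of k] by simp
  moreover have "norm (wsum (branch z a) - ?s (branch z a)) \<le> wgt k * lb k / 4"
    "norm (wsum (branch z b) - ?s (branch z b)) \<le> wgt k * lb k / 4"
    using wsum_tail_Suc[OF branch_ltow[OF z, of a], of k] wsum_tail_Suc[OF branch_ltow[OF z, of b], of k] by auto
  moreover have "norm (?s (branch z a) - ?s (branch z b)) \<le> norm (wsum (branch z a) - ?s (branch z a))
      + norm (wsum (branch z b) - ?s (branch z b)) + norm (wsum (branch z a) - wsum (branch z b))"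
    by (rule tri)
  moreover have "wgt k * lb k > 0" using wgt_pos[of k] ub_lb(1)[of k] by simp
  ultimately show ?thesis by linarith
qed

lemma branch_close:
  assumes z: "z \<in> phull Y" and ab: "\<And>j. j < n \<Longrightarrow> a j = b j"
  shows "norm (wsum (branch z a) - wsum (branch z b)) \<le> 16/7 * cf n"
proof -
  let ?s = "\<lambda>t. \<Sum>j<n. of_real (wgt j) * t j :: complex"
  have "?s (branch z a) = ?s (branch z b)"
    by (rule sum.cong) (use branch_eqI[OF ab] in auto)
  then have "wsum (branch z a) - wsum (branch z b) = (wsum (branch z a) - ?s (branch z a)) - (wsum (branch z b) - ?s (branch z b))"
    by simp
  then have "norm (wsum (branch z a) - wsum (branch z b)) \<le> norm (wsum (branch z a) - ?s (branch z a)) + norm (wsum (branch z b) - ?s (branch z b))"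
    using norm_triangle_ineq4 by metis
  then show ?thesis
    using wsum_tail[OF branch_ltow[OF z, of a], of n] wsum_tail[OF branch_ltow[OF z, of b], of n] by simp
qed

end

subsection \<open>Dense squares, Gleason parts and point derivations\<close>

lemma prod_approx:
  fixes a b p q :: complex
  assumes "norm (a - p) \<le> d" "norm (b - q) \<le> d" "norm a \<le> C" "norm b \<le> C" "d \<le> 1"
  shows "norm (a * b - p * q) \<le> d * (2 * C + 1)"
proof -
  have q: "norm q \<le> C + 1" using assms norm_triangle_ineq3[of b q] by linarith
  have "a * b - p * q = a * (b - q) + (a - p) * q" by (simp add: algebra_simps)
  then have "norm (a * b - p * q) \<le> norm a * norm (b - q) + norm (a - p) * norm q"
    by (metis norm_mult norm_triangle_ineq)
  also have "\<dots> \<le> C * d + d * (C + 1)"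
    by (intro add_mono mult_mono assms q) (use assms norm_ge_zero order_trans in blast)+
  finally show ?thesis by (simp add: algebra_simps)
qed

locale hull_point =
  fixes X :: "(complex^'n::finite) set" and z :: "complex^'n"
  assumes X_bounded: "bounded X" and X_ne: "X \<noteq> {}" and z_hull: "z \<in> phull X"
begin

sublocale fun_algebra cpoly X by (rule fun_algebra_cpoly[OF X_bounded])

lemma cpoly_diff_le:
  assumes "p \<in> cpoly" "q \<in> cpoly" "\<And>x. x \<in> X \<Longrightarrow> norm (p x - q x) \<le> C"
  shows "norm (p z - q z) \<le> C"
  by (rule phullD[OF z_hull X_ne diff_gen[OF assms(1,2)] assms(3)])

text \<open>Polynomials approaching \<open>f\<close> on \<open>X\<close> are Cauchy at
  \<open>z\<close>, because bounds on \<open>X\<close> hold on the hull. The limit comes with an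
  explicit error for every approximant; the uniqueness required by \<open>hat\<close> and its
  algebraic rules follow from that.\<close>

lemma hat_exists:
  assumes f: "f \<in> PX X"
  shows "\<exists>c. \<forall>p\<in>cpoly. \<forall>d. (\<forall>x\<in>X. norm (f x - p x) \<le> d) \<longrightarrow> norm (p z - c) \<le> d"
proof -
  have "\<exists>p\<in>cpoly. \<forall>x\<in>X. norm (f x - p x) < inverse (real (Suc n))" for n
    using f unfolding PX_def by simp
  then obtain P where P: "\<And>n. P n \<in> cpoly" "\<And>n x. x \<in> X \<Longrightarrow> norm (f x - P n x) < inverse (real (Suc n))"
    by metis
  have close: "norm (p z - P n z) \<le> d + inverse (real (Suc n))"
    if p: "p \<in> cpoly" "\<forall>x\<in>X. norm (f x - p x) \<le> d" for p d n
  proof (rule cpoly_diff_le[OF p(1) P(1)])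
    fix x assume "x \<in> X"
    then show "norm (p x - P n x) \<le> d + inverse (real (Suc n))"
      using P(2)[of x n] p(2) norm_triangle_ineq[of "p x - f x" "f x - P n x"]
      by (fastforce simp: norm_minus_commute)
  qed
  have inv0: "(\<lambda>n. inverse (real (Suc n))) \<longlonglongrightarrow> 0" by (rule LIMSEQ_inverse_real_of_nat)
  have "Cauchy (\<lambda>n. P n z)"
  proof (rule metric_CauchyI)
    fix e :: real assume "e > 0"
    then have "eventually (\<lambda>n. inverse (real (Suc n)) < e/2) sequentially"
      using order_tendstoD(2)[OF inv0, of "e/2"] by simp
    then obtain N where N: "\<And>n. n \<ge> N \<Longrightarrow> inverse (real (Suc n)) < e/2"
      by (auto simp: eventually_sequentially)
    have "dist (P m z) (P n z) < e" if "m \<ge> N" "n \<ge> N" for m n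
      using close[OF P(1)[of m], of "inverse (real (Suc m))" n] P(2)[of _ m] N[OF that(1)] N[OF that(2)]
      unfolding dist_norm by fastforce
    then show "\<exists>M. \<forall>m\<ge>M. \<forall>n\<ge>M. dist (P m z) (P n z) < e" by blast
  qed
  then obtain c where c: "(\<lambda>n. P n z) \<longlonglongrightarrow> c" using convergent_eq_Cauchy by blast
  have "norm (p z - c) \<le> d" if p: "p \<in> cpoly" "\<forall>x\<in>X. norm (f x - p x) \<le> d" for p d
  proof (rule tendsto_le[OF trivial_limit_sequentially])
    show "(\<lambda>n. norm (p z - P n z)) \<longlonglongrightarrow> norm (p z - c)" by (intro tendsto_intros c)
    show "(\<lambda>n. d + inverse (real (Suc n))) \<longlonglongrightarrow> d"
      using tendsto_add[OF tendsto_const inv0, of d] by simp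
    show "\<forall>\<^sub>F n in sequentially. norm (p z - P n z) \<le> d + inverse (real (Suc n))"
      using close[OF p] by simp
  qed
  then show ?thesis by blast
qed

lemma hat_le_approx:
  assumes f: "f \<in> PX X" and p: "p \<in> cpoly" "\<And>x. x \<in> X \<Longrightarrow> norm (f x - p x) \<le> d"
  shows "norm (p z - hat X f z) \<le> d"
proof -
  obtain c where c: "\<And>p d. p \<in> cpoly \<Longrightarrow> (\<And>x. x \<in> X \<Longrightarrow> norm (f x - p x) \<le> d) \<Longrightarrow> norm (p z - c) \<le> d"
    using hat_exists[OF f] by blast
  have "hat X f z = c" unfolding hat_def
  proof (rule the_equality)
    show "\<forall>e>0. \<exists>d>0. \<forall>p\<in>cpoly. (\<forall>x\<in>X. norm (f x - p x) < d) \<longrightarrow> norm (p z - c) < e"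
    proof (intro allI impI)
      fix e :: real assume e: "e > 0"
      have "norm (p z - c) < e" if "p \<in> cpoly" "\<forall>x\<in>X. norm (f x - p x) < e/2" for p
        using c[OF that(1), of "e/2"] that(2) e by fastforce
      then show "\<exists>d>0. \<forall>p\<in>cpoly. (\<forall>x\<in>X. norm (f x - p x) < d) \<longrightarrow> norm (p z - c) < e"
        using e by (intro exI[of _ "e/2"]) auto
    qed
    fix c' assume c': "\<forall>e>0. \<exists>d>0. \<forall>p\<in>cpoly. (\<forall>x\<in>X. norm (f x - p x) < d) \<longrightarrow> norm (p z - c') < e"
    have "norm (c' - c) \<le> 0 + e" if e: "e > 0" for e
    proof -
      obtain d where d: "d > 0" "\<And>p. p \<in> cpoly \<Longrightarrow> (\<forall>x\<in>X. norm (f x - p x) < d) \<Longrightarrow> norm (p z - c') < e/2"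
        using c' e by (meson half_gt_zero)
      have m: "min d (e/2) > 0" using d(1) e by simp
      obtain p where p: "p \<in> cpoly" "\<And>x. x \<in> X \<Longrightarrow> norm (f x - p x) < min d (e/2)"
        by (rule uclD[OF f[unfolded PX_eq_ucl] m]) blast
      have "norm (p z - c) \<le> e/2" by (rule c[OF p(1)]) (use p(2) in fastforce)
      moreover have "norm (p z - c') < e/2" by (rule d(2)[OF p(1)]) (use p(2) in fastforce)
      ultimately show ?thesis
        using norm_triangle_ineq[of "c' - p z" "p z - c"] by (simp add: norm_minus_commute)
    qed
    then have "norm (c' - c) \<le> 0" by (rule field_le_epsilon)
    then show "c' = c" by simp
  qed
  then show ?thesis using c[OF p] by simp
qed

lemma hat_eqI:
  assumes f: "f \<in> PX X"
    and c: "\<And>e. e > 0 \<Longrightarrow> \<exists>p\<in>cpoly. (\<forall>x\<in>X. norm (f x - p x) \<le> e) \<and> norm (p z - c) \<le> e"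
  shows "hat X f z = c"
proof -
  have "norm (hat X f z - c) \<le> 0 + e" if e: "e > 0" for e
  proof -
    obtain p where p: "p \<in> cpoly" "\<forall>x\<in>X. norm (f x - p x) \<le> e/2" "norm (p z - c) \<le> e/2"
      using c[OF half_gt_zero[OF e]] by blast
    have "norm (p z - hat X f z) \<le> e/2" by (rule hat_le_approx[OF f p(1)]) (use p(2) in blast)
    then show ?thesis
      using p(3) norm_triangle_ineq[of "hat X f z - p z" "p z - c"] by (simp add: norm_minus_commute)
  qed
  then have "norm (hat X f z - c) \<le> 0" by (rule field_le_epsilon)
  then show ?thesis by simp
qed

lemma cpoly_PX: "p \<in> cpoly \<Longrightarrow> p \<in> PX X"
  unfolding PX_eq_ucl by (rule subsetD[OF ucl_subset_gens])

lemma hat_cpoly: "p \<in> cpoly \<Longrightarrow> hat X p z = p z"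
  by (rule hat_eqI[OF cpoly_PX]) (auto intro: bexI[of _ p])

lemma hat_cong:
  assumes "\<And>x. x \<in> X \<Longrightarrow> f x = g x"
  shows "hat X f z = hat X g z"
proof -
  have eq: "(\<forall>x\<in>X. norm (f x - p x) < d) \<longleftrightarrow> (\<forall>x\<in>X. norm (g x - p x) < d)" for p d
    using assms by simp
  show ?thesis unfolding hat_def eq ..
qed

lemma PX_approx:
  assumes "f \<in> PX X" "e > 0"
  obtains p where "p \<in> cpoly" "\<And>x. x \<in> X \<Longrightarrow> norm (f x - p x) \<le> e" "norm (p z - hat X f z) \<le> e"
proof -
  obtain p where p: "p \<in> cpoly" "\<And>x. x \<in> X \<Longrightarrow> norm (f x - p x) < e"
    using uclD[OF assms[unfolded PX_eq_ucl]] by blast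
  show ?thesis
    by (rule that[OF p(1) less_imp_le[OF p(2)] hat_le_approx[OF assms(1) p(1) less_imp_le[OF p(2)]]])
qed

lemma hat_le:
  assumes "f \<in> PX X" "\<And>x. x \<in> X \<Longrightarrow> norm (f x) \<le> C"
  shows "norm (hat X f z) \<le> C"
  using hat_le_approx[OF assms(1) const[of 0], of C] assms(2) by simp

lemma hat_add:
  assumes "f \<in> PX X" "g \<in> PX X"
  shows "hat X (\<lambda>x. f x + g x) z = hat X f z + hat X g z"
proof (rule hat_eqI)
  show "(\<lambda>x. f x + g x) \<in> PX X" using assms unfolding PX_eq_ucl by (rule add_ucl)
  fix e :: real assume "e > 0"
  then have e2: "e/2 > 0" by simp
  obtain p where p: "p \<in> cpoly" "\<And>x. x \<in> X \<Longrightarrow> norm (f x - p x) \<le> e/2" "norm (p z - hat X f z) \<le> e/2"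
    by (rule PX_approx[OF assms(1) e2]) blast
  obtain q where q: "q \<in> cpoly" "\<And>x. x \<in> X \<Longrightarrow> norm (g x - q x) \<le> e/2" "norm (q z - hat X g z) \<le> e/2"
    by (rule PX_approx[OF assms(2) e2]) blast
  have tri: "norm (a + b - (c + d)) \<le> e" if "norm (a - c) \<le> e/2" "norm (b - d) \<le> e/2" for a b c d :: complex
    using that norm_triangle_ineq[of "a - c" "b - d"] by (simp add: algebra_simps)
  show "\<exists>r\<in>cpoly. (\<forall>x\<in>X. norm (f x + g x - r x) \<le> e) \<and> norm (r z - (hat X f z + hat X g z)) \<le> e"
    by (rule bexI[OF _ add[OF p(1) q(1)]]) (intro conjI ballI tri p q)
qed

lemma hat_mult:
  assumes "f \<in> PX X" "g \<in> PX X"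
  shows "hat X (\<lambda>x. f x * g x) z = hat X f z * hat X g z"
proof (rule hat_eqI)
  show "(\<lambda>x. f x * g x) \<in> PX X" using assms unfolding PX_eq_ucl by (rule mult_ucl)
  fix e :: real assume e: "e > 0"
  obtain C where C: "C > 0" "\<And>x. x \<in> X \<Longrightarrow> norm (f x) \<le> C"
    by (rule bounded_ucl[OF assms(1)[unfolded PX_eq_ucl]]) blast
  obtain D where D: "\<And>x. x \<in> X \<Longrightarrow> norm (g x) \<le> D"
    by (rule bounded_ucl[OF assms(2)[unfolded PX_eq_ucl]]) blast
  define M where "M = max C D"
  have M: "M > 0" "\<And>x. x \<in> X \<Longrightarrow> norm (f x) \<le> M" "\<And>x. x \<in> X \<Longrightarrow> norm (g x) \<le> M"
    using C D by (force simp: M_def)+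
  have Mz: "norm (hat X f z) \<le> M" "norm (hat X g z) \<le> M" by (rule hat_le[OF assms(1) M(2)] hat_le[OF assms(2) M(3)], assumption)+
  define d where "d = min 1 (e / (2*M+1))"
  have d: "d > 0" "d \<le> 1" using e M(1) by (auto simp: d_def)
  have "d * (2*M+1) \<le> e / (2*M+1) * (2*M+1)" by (rule mult_right_mono) (use M(1) in \<open>auto simp: d_def\<close>)
  then have de: "d * (2*M+1) \<le> e" using M(1) by simp
  obtain p where p: "p \<in> cpoly" "\<And>x. x \<in> X \<Longrightarrow> norm (f x - p x) \<le> d" "norm (p z - hat X f z) \<le> d"
    by (rule PX_approx[OF assms(1) d(1)]) blast
  obtain q where q: "q \<in> cpoly" "\<And>x. x \<in> X \<Longrightarrow> norm (g x - q x) \<le> d" "norm (q z - hat X g z) \<le> d"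
    by (rule PX_approx[OF assms(2) d(1)]) blast
  show "\<exists>r\<in>cpoly. (\<forall>x\<in>X. norm (f x * g x - r x) \<le> e) \<and> norm (r z - (hat X f z * hat X g z)) \<le> e"
  proof (rule bexI[OF _ mult[OF p(1) q(1)]], intro conjI ballI)
    show "norm (f x * g x - p x * q x) \<le> e" if x: "x \<in> X" for x
      by (rule order_trans[OF prod_approx[OF p(2)[OF x] q(2)[OF x] M(2)[OF x] M(3)[OF x] d(2)] de])
    have "norm (hat X f z * hat X g z - p z * q z) \<le> d * (2*M+1)"
      by (rule prod_approx[OF _ _ Mz d(2)]) (use p(3) q(3) in \<open>simp_all add: norm_minus_commute\<close>)
    then show "norm (p z * q z - hat X f z * hat X g z) \<le> e" using de by (simp add: norm_minus_commute)
  qed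
qed

lemma supn_ge: "f \<in> PX X \<Longrightarrow> x \<in> X \<Longrightarrow> norm (f x) \<le> supn X f"
proof -
  assume f: "f \<in> PX X" and x: "x \<in> X"
  obtain C where "\<And>x. x \<in> X \<Longrightarrow> norm (f x) \<le> C"
    by (rule bounded_ucl[OF f[unfolded PX_eq_ucl]]) blast
  then show ?thesis unfolding supn_def by (intro cSUP_upper[OF x] bdd_aboveI2)
qed

lemma supn_le: "(\<And>x. x \<in> X \<Longrightarrow> norm (f x) \<le> C) \<Longrightarrow> supn X f \<le> C"
  unfolding supn_def by (rule cSUP_least[OF X_ne])

text \<open>If \<open>p\<close> vanishes at \<open>z\<close> and is close to \<open>g^2\<close>,
  then \<open>g z\<close> is small, and so is \<open>psi (g^2) = 2 * g z * psi g\<close>;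
  boundedness controls \<open>psi g\<close> and the error. Constants are annihilated, and
  polynomials are dense.\<close>

lemma no_bounded_point_derivation:
  assumes sq: "\<And>p e. p \<in> cpoly \<Longrightarrow> e > 0 \<Longrightarrow> \<exists>g\<in>cpoly. \<forall>x\<in>X. norm (p x - (g x)\<^sup>2) \<le> e"
    and psi: "bounded_point_derivation X z psi" and f: "f \<in> PX X"
  shows "psi f = 0"
proof -
  note pd = psi[unfolded bounded_point_derivation_def point_derivation_def]
  have lin: "psi (\<lambda>x. f x + g x) = psi f + psi g" "psi (\<lambda>x. c * f x) = c * psi f"
    and leib: "psi (\<lambda>x. f x * g x) = psi f * hat X g z + hat X f z * psi g"
    if "f \<in> PX X" "g \<in> PX X" for f g c using pd that by blast+
  obtain C0 where C0: "\<And>f. f \<in> PX X \<Longrightarrow> norm (psi f) \<le> C0 * supn X f" using pd by blast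
  define C where "C = \<bar>C0\<bar>"
  have C: "norm (psi f) \<le> C * M" if "f \<in> PX X" "\<And>x. x \<in> X \<Longrightarrow> norm (f x) \<le> M" for f M
  proof -
    obtain x where x: "x \<in> X" using X_ne by blast
    have "0 \<le> supn X f" using supn_ge[OF that(1) x] norm_ge_zero order_trans by blast
    then have "C0 * supn X f \<le> C * M"
      unfolding C_def using supn_le[OF that(2)] by (intro mult_mono) auto
    with C0[OF that(1)] show ?thesis by linarith
  qed
  have C_nonneg: "C \<ge> 0" by (simp add: C_def)
  have diff: "psi (\<lambda>x. f x - g x) = psi f - psi g" if "f \<in> PX X" "g \<in> PX X" for f g
    using lin(1)[OF that(1), of "\<lambda>x. -1 * g x"] lin(2)[OF that(2) that(2), of "-1"]
      cmult_ucl[of g "-1"] that by (simp add: PX_eq_ucl)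
  have one: "psi (\<lambda>x. 1) = 0"
    using leib[OF cpoly_PX[OF const] cpoly_PX[OF const], of 1 1] hat_cpoly[OF const, of 1] by simp
  have cst: "psi (\<lambda>x. c) = 0" for c
    using lin(2)[OF cpoly_PX[OF const] cpoly_PX[OF const], of c 1] one by simp
  have zero: "psi p = 0" if p: "p \<in> cpoly" "p z = 0" for p
  proof -
    obtain M where M: "M > 0" "\<And>x. x \<in> X \<Longrightarrow> norm (p x) \<le> M"
      using bounded_ucl[OF subsetD[OF ucl_subset_gens p(1)]] by blast
    have est: "norm (psi p) \<le> 0 + (C + 2 * C * (M + 2)) * e" if e: "0 < e" "e < 1" for e
    proof -
      \<comment> \<open>Accuracy \<open>e^2\<close> is requested so that \<open>p z = 0\<close>
        yields \<open>norm (g z) \<le> e\<close>.\<close>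
      obtain g where g: "g \<in> cpoly" "\<forall>x\<in>X. norm (p x - (g x)\<^sup>2) \<le> e\<^sup>2"
        using sq[OF p(1), of "e\<^sup>2"] e by auto
      have g2: "(\<lambda>x. g x * g x) \<in> cpoly" by (rule mult[OF g(1) g(1)])
      have gX: "g \<in> PX X" by (rule cpoly_PX[OF g(1)])
      have "norm (p z - g z * g z) \<le> e\<^sup>2"
        by (rule cpoly_diff_le[OF p(1) g2]) (use g(2) in \<open>simp add: power2_eq_square\<close>)
      then have "(norm (g z))\<^sup>2 \<le> e\<^sup>2" by (simp add: p(2) norm_mult power2_eq_square)
      then have gz: "norm (g z) \<le> e" by (rule power2_le_imp_le) (use e in simp)
      have gb: "norm (g x) \<le> M + 2" if x: "x \<in> X" for x
      proof (rule power2_le_imp_le)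
        have "norm ((g x)\<^sup>2) \<le> norm (p x) + e\<^sup>2"
          using g(2) x norm_triangle_ineq2[of "(g x)\<^sup>2" "p x"] by (force simp: norm_minus_commute)
        moreover have "e\<^sup>2 \<le> 1" using e by (simp add: power_le_one)
        ultimately have "(norm (g x))\<^sup>2 \<le> M + 1" using M(2)[OF x] by (simp add: norm_power)
        also have "\<dots> \<le> (M + 2)\<^sup>2" using M(1) by (simp add: power2_eq_square algebra_simps)
        finally show "(norm (g x))\<^sup>2 \<le> (M + 2)\<^sup>2" .
      qed (use M in simp)
      have "psi p = psi (\<lambda>x. p x - g x * g x) + 2 * g z * psi g"
        using diff[OF cpoly_PX[OF p(1)] cpoly_PX[OF g2]] leib[OF gX gX] hat_cpoly[OF g(1)] by simp
      then have "norm (psi p) \<le> norm (psi (\<lambda>x. p x - g x * g x)) + 2 * norm (g z) * norm (psi g)"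
        using norm_triangle_ineq[of "psi (\<lambda>x. p x - g x * g x)" "2 * g z * psi g"] by (simp add: norm_mult)
      also have "norm (psi (\<lambda>x. p x - g x * g x)) \<le> C * e\<^sup>2"
        by (rule C[OF cpoly_PX[OF diff_gen[OF p(1) g2]]]) (use g(2) in \<open>simp add: power2_eq_square\<close>)
      also have "C * e\<^sup>2 \<le> C * e"
        using e C_nonneg by (intro mult_left_mono) (auto simp: power2_eq_square)
      also have "2 * norm (g z) * norm (psi g) \<le> 2 * e * (C * (M + 2))"
        by (intro mult_mono C[OF gX gb] gz) (use e in auto)
      finally show ?thesis by (simp add: algebra_simps)
    qed
    show ?thesis
    proof (rule ccontr)
      assume "psi p \<noteq> 0"
      \<comment> \<open>The summand 1 makes \<open>K\<close> positive even if \<open>C = 0\<close>;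
        \<open>e\<close> is then so small that the estimate would give at most half of
        \<open>norm (psi p)\<close>.\<close>
      define K where "K = C + 2 * C * (M + 2) + 1"
      have K: "K > 0" using C_nonneg M(1) by (simp add: K_def add_nonneg_pos)
      define e where "e = min (1/2) (norm (psi p) / (2 * K))"
      have e: "0 < e" "e < 1" using \<open>psi p \<noteq> 0\<close> K by (auto simp: e_def)
      have "norm (psi p) \<le> (K - 1) * e" using est[OF e] by (simp add: K_def)
      also have "\<dots> \<le> K * e" using e by (simp add: algebra_simps)
      also have "\<dots> \<le> K * (norm (psi p) / (2 * K))" using K by (intro mult_left_mono) (auto simp: e_def)
      also have "\<dots> = norm (psi p) / 2" using K by simp
      finally show False using \<open>psi p \<noteq> 0\<close> by simp
    qed
  qed
  have poly: "psi p = 0" if p: "p \<in> cpoly" for p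
    using zero[OF diff_gen[OF p const[of "p z"]]] diff[OF cpoly_PX[OF p] cpoly_PX[OF const]] cst by simp
  have "norm (psi f) \<le> 0 + e" if e: "e > 0" for e
  proof -
    have d: "e / (C + 1) > 0" using e C_nonneg by simp
    obtain p where p: "p \<in> cpoly" "\<And>x. x \<in> X \<Longrightarrow> norm (f x - p x) \<le> e / (C + 1)"
      by (rule PX_approx[OF f d]) blast
    have "(\<lambda>x. f x - p x) \<in> PX X" using f cpoly_PX[OF p(1)] unfolding PX_eq_ucl by (rule diff_ucl)
    then have "norm (psi (\<lambda>x. f x - p x)) \<le> C * (e / (C + 1))" by (rule C[OF _ p(2)])
    also have "\<dots> \<le> e" using e C_nonneg by (simp add: field_simps)
    finally show ?thesis using diff[OF f cpoly_PX[OF p(1)]] poly[OF p(1)] by simp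
  qed
  then have "norm (psi f) \<le> 0" by (rule field_le_epsilon)
  then show ?thesis by simp
qed

end

text \<open>The pseudo-hyperbolic distance \<open>s\<close> of two distinct points satisfies \<open>s \<le> s\<^sup>2\<close>, because a function vanishing
  at \<open>z\<close> may be replaced by an approximate square root of itself.\<close>

lemma separating_cpoly:
  fixes X :: "(complex^'n::finite) set"
  assumes X: "bounded X" "X \<noteq> {}" and z: "z \<in> phull X" and w: "w \<in> phull X" and "z \<noteq> w"
    and sq: "\<And>p e. p \<in> cpoly \<Longrightarrow> e > 0 \<Longrightarrow> \<exists>g\<in>cpoly. \<forall>x\<in>X. norm (p x - (g x)\<^sup>2) \<le> e"
    and r: "r < 1"
  obtains p where "p \<in> cpoly" "\<And>x. x \<in> X \<Longrightarrow> norm (p x) \<le> 1" "p z = 0" "norm (p w) > r"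
proof -
  interpret Z: hull_point X z by unfold_locales (use X z in auto)
  interpret W: hull_point X w by unfold_locales (use X w in auto)
  define S where "S = {norm (p w) |p. p \<in> cpoly \<and> (\<forall>x\<in>X. norm (p x) \<le> 1) \<and> p z = 0}"
  have S1: "s \<le> 1" if "s \<in> S" for s
    using that phullD[OF w X(2)] unfolding S_def by blast
  have bdd: "bdd_above S" using S1 by (rule bdd_aboveI)
  define s where "s = Sup S"
  obtain i where i: "z $ i \<noteq> w $ i" using \<open>z \<noteq> w\<close> by (auto simp: vec_eq_iff)
  \<comment> \<open>A rescaled coordinate separating \<open>z\<close> from \<open>w\<close> shows
    that the supremum is positive; this excludes the solution \<open>s = 0\<close> of
    \<open>s \<le> s^2\<close>.\<close>
  have "\<exists>t\<in>S. t > 0"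
  proof -
    have c: "(\<lambda>x. x $ i - z $ i) \<in> cpoly" by (rule Z.diff_gen[OF cpoly.coord cpoly.const])
    obtain M where M: "M > 0" "\<And>x. x \<in> X \<Longrightarrow> norm (x $ i - z $ i) \<le> M"
      using Z.bounded_ucl[OF subsetD[OF ucl_subset_gens c]] by blast
    let ?p = "\<lambda>x. of_real (1/M) * (x $ i - z $ i)"
    have "?p \<in> cpoly" by (rule cpoly.mult[OF cpoly.const c])
    moreover have "\<forall>x\<in>X. norm (?p x) \<le> 1" using M by (simp add: norm_mult norm_divide)
    ultimately have "norm (?p w) \<in> S" unfolding S_def by (intro CollectI exI[of _ ?p]) simp
    moreover have "norm (?p w) > 0" using i M(1) by simp
    ultimately show ?thesis by blast
  qed
  then obtain t where t: "t \<in> S" "t > 0" by blast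
  have sS: "u \<le> s" if "u \<in> S" for u unfolding s_def by (rule cSup_upper[OF that bdd])
  have s0: "s > 0" using sS[OF t(1)] t(2) by simp
  have s1: "s \<le> 1" unfolding s_def by (rule cSup_least) (use t S1 in auto)
  have "u \<le> s\<^sup>2" if u: "u \<in> S" for u
  proof -
    obtain p where p: "p \<in> cpoly" "\<forall>x\<in>X. norm (p x) \<le> 1" "p z = 0" "u = norm (p w)"
      using u unfolding S_def by blast
    have est: "u \<le> s\<^sup>2 + 16 * e" if e: "0 < e" "e < 1" for e
    proof -
      obtain g where g: "g \<in> cpoly" "\<forall>x\<in>X. norm (p x - (g x)\<^sup>2) \<le> e\<^sup>2"
        using sq[OF p(1), of "e\<^sup>2"] e by auto
      have g2: "(\<lambda>x. g x * g x) \<in> cpoly" by (rule cpoly.mult[OF g(1) g(1)])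
      have g2': "norm (p x - g x * g x) \<le> e\<^sup>2" if "x \<in> X" for x using g(2) that by (simp add: power2_eq_square)
      have "norm (p z - g z * g z) \<le> e\<^sup>2" by (rule Z.cpoly_diff_le[OF p(1) g2 g2'])
      then have "(norm (g z))\<^sup>2 \<le> e\<^sup>2" by (simp add: p(3) norm_mult power2_eq_square)
      then have gz: "norm (g z) \<le> e" by (rule power2_le_imp_le) (use e in simp)
      have gb: "norm (g x) \<le> 1 + e" if x: "x \<in> X" for x
      proof (rule power2_le_imp_le)
        have "norm ((g x)\<^sup>2) \<le> 1 + e\<^sup>2"
          using g(2) p(2) x norm_triangle_ineq2[of "(g x)\<^sup>2" "p x"] by (force simp: norm_minus_commute)
        then have "(norm (g x))\<^sup>2 \<le> 1 + e\<^sup>2" by (simp add: norm_power)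
        also have "\<dots> \<le> (1 + e)\<^sup>2" using e(1) by (simp add: power2_eq_square algebra_simps)
        finally show "(norm (g x))\<^sup>2 \<le> (1 + e)\<^sup>2" .
      qed (use e in simp)
      \<comment> \<open>The approximate root is shifted to vanish at \<open>z\<close> and divided by
        \<open>(1 + e) + e\<close>, the bounds for \<open>g\<close> on \<open>X\<close> and at
        \<open>z\<close>, to become a competitor for \<open>s\<close>.\<close>
      let ?h = "\<lambda>x. of_real (1 / (1 + 2*e)) * (g x - g z)"
      have "?h \<in> cpoly" by (rule cpoly.mult[OF cpoly.const Z.diff_gen[OF g(1) cpoly.const]])
      moreover have "norm (?h x) \<le> 1" if x: "x \<in> X" for x
      proof -
        have "norm (g x - g z) \<le> 1 + 2*e" using gb[OF x] gz norm_triangle_ineq4[of "g x" "g z"] by linarith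
        moreover have "norm (?h x) = norm (g x - g z) / (1 + 2*e)" unfolding norm_mult norm_of_real using e by simp
        ultimately show ?thesis using e by simp
      qed
      ultimately have "norm (?h w) \<in> S" unfolding S_def by (intro CollectI exI[of _ ?h]) auto
      then have "norm (?h w) \<le> s" by (rule sS)
      moreover have "norm (?h w) = norm (g w - g z) / (1 + 2*e)" unfolding norm_mult norm_of_real using e by simp
      ultimately have "norm (g w - g z) / (1 + 2*e) \<le> s" by (simp only:)
      then have "norm (g w - g z) \<le> s * (1 + 2*e)" using e by (simp add: pos_divide_le_eq)
      also have "\<dots> \<le> s + 2*e" using s1 e mult_right_mono[OF s1, of e] by (simp add: algebra_simps)
      finally have gw: "norm (g w) \<le> s + 3*e" using gz norm_triangle_ineq2[of "g w" "g z"] by linarith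
      have "norm (p w - g w * g w) \<le> e\<^sup>2" by (rule W.cpoly_diff_le[OF p(1) g2 g2'])
      then have "u \<le> (norm (g w))\<^sup>2 + e\<^sup>2"
        using norm_triangle_ineq2[of "p w" "g w * g w"] by (simp add: p(4) norm_mult power2_eq_square)
      also have "(norm (g w))\<^sup>2 \<le> (s + 3*e)\<^sup>2" by (rule power_mono[OF gw]) simp
      also have "(s + 3*e)\<^sup>2 + e\<^sup>2 = s\<^sup>2 + 6 * (s * e) + 10 * (e * e)" by (simp add: power2_eq_square algebra_simps)
      also have "\<dots> \<le> s\<^sup>2 + 6 * (1 * e) + 10 * (1 * e)"
        using s1 e by (intro add_mono mult_left_mono mult_right_mono) auto
      finally show ?thesis by simp
    qed
    show ?thesis
    proof (rule field_le_epsilon)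
      fix e :: real assume e: "e > 0"
      have "u \<le> s\<^sup>2 + 16 * min (1/2) (e/16)" by (rule est) (use e in auto)
      also have "\<dots> \<le> s\<^sup>2 + e" by auto
      finally show "u \<le> s\<^sup>2 + e" .
    qed
  qed
  then have "s \<le> s\<^sup>2" unfolding s_def[symmetric] using t(1) by (subst s_def) (rule cSup_least, auto)
  then have "1 \<le> s" using s0 by (simp add: power2_eq_square)
  then have "r < Sup S" using r by (simp add: s_def)
  then obtain u where "u \<in> S" "r < u" using t(1) less_cSupD by blast
  then show ?thesis using that unfolding S_def by blast
qed

text \<open>The squares differ by \<open>(1 - a^2) * (1 - (norm q)^2)\<close>: the Moebius map
  taking \<open>a\<close> to 0 preserves the unit disk.\<close>

lemma moebius_le:
  fixes q :: complex
  assumes "norm q \<le> 1" "0 \<le> a" "a < 1"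
  shows "norm (q - of_real a) \<le> norm (1 - of_real a * q)"
proof (rule power2_le_imp_le)
  have "(norm (1 - of_real a * q))\<^sup>2 - (norm (q - of_real a))\<^sup>2 = (1 - a\<^sup>2) * (1 - (norm q)\<^sup>2)"
    unfolding cmod_power2 by (simp add: power2_eq_square algebra_simps)
  also have "\<dots> \<ge> 0" using assms by (intro mult_nonneg_nonneg) (auto simp: power_le_one)
  finally show "(norm (q - of_real a))\<^sup>2 \<le> (norm (1 - of_real a * q))\<^sup>2" by simp
qed simp

text \<open>A polynomial bounded by 1 that vanishes at \<open>z\<close> and has modulus nearly 1 at
  \<open>w\<close> is followed by the Moebius map \<open>(q - a) / (1 - a q)\<close>. The values
  become \<open>-a\<close> at \<open>z\<close> and at least \<open>a\<close> at \<open>w\<close>, so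
  the distance is at least \<open>2 * a\<close> for every \<open>a < 1\<close>.\<close>

lemma one_point_partI:
  fixes X :: "(complex^'n::finite) set"
  assumes X: "bounded X" "X \<noteq> {}" and z: "z \<in> phull X"
    and sq: "\<And>p e. p \<in> cpoly \<Longrightarrow> e > 0 \<Longrightarrow> \<exists>g\<in>cpoly. \<forall>x\<in>X. norm (p x - (g x)\<^sup>2) \<le> e"
  shows "one_point_part X z"
  unfolding one_point_part_def
proof (intro ballI impI)
  fix w assume w: "w \<in> phull X" and gd: "gdist X z w < 2"
  interpret Z: hull_point X z by unfold_locales (use X z in auto)
  interpret W: hull_point X w by unfold_locales (use X w in auto)
  show "w = z"
  proof (rule ccontr)
    assume "w \<noteq> z"
    then have "z \<noteq> w" by simp
    have key: "2 * a \<le> gdist X z w" if a: "0 < a" "a < 1" for a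
    proof -
      have a2: "0 < 1 + a\<^sup>2" using a by (simp add: add_pos_nonneg)
      have "0 < (1 - a)\<^sup>2" using a by simp
      \<comment> \<open>This threshold is the point that the Moebius map sends to
        \<open>a\<close>.\<close>
      then have "2 * a / (1 + a\<^sup>2) < 1" using a2 by (simp add: power2_eq_square algebra_simps)
      then obtain p where p: "p \<in> cpoly" "\<And>x. x \<in> X \<Longrightarrow> norm (p x) \<le> 1" "p z = 0" "norm (p w) > 2 * a / (1 + a\<^sup>2)"
        using separating_cpoly[OF X z w \<open>z \<noteq> w\<close> sq] by blast
      have "2 * a / (1 + a\<^sup>2) > 0" using a a2 by simp
      then have pw: "norm (p w) > 0" using p(4) by linarith
      \<comment> \<open>A rotation that makes the value at \<open>w\<close> real and
        positive.\<close>
      define q where "q = (\<lambda>x. (cnj (p w) / of_real (norm (p w))) * p x)"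
      have q: "q \<in> cpoly" unfolding q_def by (rule cpoly.mult[OF cpoly.const p(1)])
      have qX: "norm (q x) \<le> 1" if "x \<in> X" for x using p(2)[OF that] pw by (simp add: q_def norm_mult norm_divide)
      have qz: "q z = 0" by (simp add: q_def p(3))
      define r where "r = norm (p w)"
      have qw: "q w = of_real r"
        using pw complex_norm_square[of "p w"] by (simp add: q_def r_def power2_eq_square mult.commute divide_simps)
      have r1: "r \<le> 1" using phullD[OF w X(2) p(1) p(2)] by (simp add: r_def)
      have r2: "2 * a < r * (1 + a\<^sup>2)" using p(4) a2 by (simp add: r_def field_simps)
      define d where "d = (\<lambda>x. 1 - of_real a * q x)"
      have dc: "d \<in> cpoly" unfolding d_def by (rule Z.diff_gen[OF cpoly.const cpoly.mult[OF cpoly.const q]])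
      have dX: "norm (d x - 1) \<le> a" if "x \<in> X" for x
        using mult_left_mono[OF qX[OF that], of a] a by (simp add: d_def norm_mult)
      have d0: "d x \<noteq> 0" if "x \<in> X" for x using dX[OF that] a by auto
      have idX: "(\<lambda>x. 1 / d x) \<in> ucl cpoly X"
        by (rule Z.inverse_ucl[OF subsetD[OF ucl_subset_gens dc] a(2) dX])
      define f where "f = (\<lambda>x. (q x - of_real a) * (1 / d x))"
      have qa: "(\<lambda>x. q x - of_real a) \<in> cpoly" by (rule Z.diff_gen[OF q cpoly.const])
      have f: "f \<in> PX X" unfolding PX_eq_ucl f_def
        by (rule Z.mult_ucl[OF subsetD[OF ucl_subset_gens qa] idX])
      have f1: "supn X f \<le> 1"
      proof (rule Z.supn_le)
        fix x assume x: "x \<in> X"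
        have "norm (q x - of_real a) \<le> norm (d x)"
          unfolding d_def by (rule moebius_le[OF qX[OF x]]) (use a in auto)
        then show "norm (f x) \<le> 1" using d0[OF x] by (simp add: f_def norm_mult norm_divide)
      qed
      have fd: "f x * d x = q x - of_real a" if "x \<in> X" for x using d0[OF that] by (simp add: f_def)
      have "hat X f z * d z = q z - of_real a"
        using Z.hat_cong[OF fd] Z.hat_mult[OF f Z.cpoly_PX[OF dc]] Z.hat_cpoly[OF dc] Z.hat_cpoly[OF qa] by simp
      then have hz: "hat X f z = - of_real a" by (simp add: d_def qz)
      have "hat X f w * d w = q w - of_real a"
        using W.hat_cong[OF fd] W.hat_mult[OF f W.cpoly_PX[OF dc]] W.hat_cpoly[OF dc] W.hat_cpoly[OF qa] by simp
      then have hw: "hat X f w * of_real (1 - a * r) = of_real (r - a)" by (simp add: d_def qw)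
      have ar: "1 - a * r > 0" using a mult_left_mono[OF r1, of a] by linarith
      have "hat X f w = of_real ((r - a) / (1 - a * r))"
        using hw ar by (simp add: field_simps flip: of_real_mult)
      then have "hat X f z - hat X f w = - of_real (a + (r - a) / (1 - a * r))" by (simp add: hz)
      moreover have "a \<le> (r - a) / (1 - a * r)"
        using r2 ar by (simp add: field_simps power2_eq_square)
      ultimately have "2 * a \<le> norm (hat X f z - hat X f w)"
        using a by (simp del: of_real_add of_real_divide)
      also have "\<dots> \<le> gdist X z w" unfolding gdist_def
      proof (rule cSUP_upper)
        show "f \<in> {f \<in> PX X. supn X f \<le> 1}" using f f1 by simp
        show "bdd_above ((\<lambda>f. norm (hat X f z - hat X f w)) ` {f \<in> PX X. supn X f \<le> 1})"
        proof (rule bdd_aboveI2[of _ _ 2])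
          fix f assume "f \<in> {f \<in> PX X. supn X f \<le> 1}"
          then have f: "f \<in> PX X" "supn X f \<le> 1" by auto
          have "norm (f x) \<le> 1" if "x \<in> X" for x using Z.supn_ge[OF f(1) that] f(2) by simp
          then have "norm (hat X f z) \<le> 1" "norm (hat X f w) \<le> 1"
            using Z.hat_le[OF f(1)] W.hat_le[OF f(1)] by blast+
          then show "norm (hat X f z - hat X f w) \<le> 2"
            using norm_triangle_ineq4[of "hat X f z" "hat X f w"] by linarith
        qed
      qed
      finally show ?thesis .
    qed
    \<comment> \<open>Twice this \<open>a\<close> is at least \<open>gdist X z w / 2 + 1\<close>,
      which exceeds \<open>gdist X z w\<close> as the latter is below 2; the maximum with 1/2 keeps
      \<open>a\<close> positive.\<close>
    have "2 * max (1/2) ((gdist X z w / 2 + 1) / 2) \<le> gdist X z w" by (rule key) (use gd in auto)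
    then show False using gd by (auto simp: max_def split: if_splits)
  qed
qed

subsection \<open>Cantor sets as boundaries of binary trees\<close>

text \<open>Uniform continuity of \<open>f\<close> on the Cantor space of bit sequences and, in the
  second clause, of its inverse, written with initial segments in place of the product
  topology.\<close>

definition tree_embedding :: "((nat \<Rightarrow> bool) \<Rightarrow> 'a::metric_space) \<Rightarrow> bool" where
  "tree_embedding f \<longleftrightarrow>
     (\<forall>e>0. \<exists>n. \<forall>a b. (\<forall>j<n. a j = b j) \<longrightarrow> dist (f a) (f b) < e) \<and>
     (\<forall>k. \<exists>d>0. \<forall>a b. (\<forall>j<k. a j = b j) \<and> a k \<noteq> b k \<longrightarrow> d \<le> dist (f a) (f b))"

lemma tree_embedding_agree:
  assumes "tree_embedding f"
  shows "\<exists>d>0. \<forall>a b. dist (f a) (f b) < d \<longrightarrow> (\<forall>j<n. a j = b j)"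
proof (induction n)
  case (Suc n)
  then obtain d where d: "d > 0" "\<And>a b. dist (f a) (f b) < d \<Longrightarrow> (\<forall>j<n. a j = b j)" by blast
  obtain d' where d': "d' > 0" "\<And>a b. (\<forall>j<n. a j = b j) \<Longrightarrow> a n \<noteq> b n \<Longrightarrow> d' \<le> dist (f a) (f b)"
    using assms unfolding tree_embedding_def by metis
  have "\<forall>j<Suc n. a j = b j" if "dist (f a) (f b) < min d d'" for a b
    using d(2)[of a b] d'(2)[of a b] that less_Suc_eq by fastforce
  with d(1) d'(1) show ?case by (intro exI[of _ "min d d'"]) auto
qed (use zero_less_one in blast)

lemma tree_embedding_inj:
  assumes "tree_embedding f"
  shows "inj f"
proof (rule injI)
  fix a b assume "f a = f b"
  then have "a n = b n" for n
    using tree_embedding_agree[OF assms, of "Suc n"] by (metis dist_self lessI)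
  then show "a = b" by blast
qed

lemma tree_embedding_continuous:
  assumes f: "tree_embedding f" and g: "tree_embedding g"
  shows "continuous_on (range f) (\<lambda>x. g (inv f x))"
  unfolding continuous_on_iff
proof (intro ballI allI impI)
  fix x and e :: real assume x: "x \<in> range f" and e: "e > 0"
  obtain n where n: "\<And>a b. (\<forall>j<n. a j = b j) \<Longrightarrow> dist (g a) (g b) < e"
    using g e unfolding tree_embedding_def by metis
  obtain d where d: "d > 0" "\<And>a b. dist (f a) (f b) < d \<Longrightarrow> (\<forall>j<n. a j = b j)"
    using tree_embedding_agree[OF f] by metis
  have "dist (g (inv f y)) (g (inv f x)) < e" if "y \<in> range f" "dist y x < d" for y
    using n[OF d(2)[of "inv f y" "inv f x"]] that x by (simp add: f_inv_into_f)
  with d(1) show "\<exists>d>0. \<forall>y\<in>range f. dist y x < d \<longrightarrow> dist (g (inv f y)) (g (inv f x)) < e" by blast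
qed

lemma tree_embedding_homeomorphic:
  assumes f: "tree_embedding f" and g: "tree_embedding g"
  shows "range f homeomorphic range g"
proof (rule homeomorphicI[where f = "\<lambda>x. g (inv f x)" and g = "\<lambda>x. f (inv g x)"])
  note inj = inv_f_f[OF tree_embedding_inj[OF f]] inv_f_f[OF tree_embedding_inj[OF g]]
  show "(\<lambda>x. g (inv f x)) ` range f = range g" "(\<lambda>x. f (inv g x)) ` range g = range f"
    by (simp_all add: image_image inj)
  show "f (inv g (g (inv f x))) = x" if "x \<in> range f" for x using that by (auto simp: inj)
  show "g (inv f (f (inv g y))) = y" if "y \<in> range g" for y using that by (auto simp: inj)
qed (rule tree_embedding_continuous[OF f g] tree_embedding_continuous[OF g f])+

text \<open>Sequences that first differ at \<open>k\<close> have partial sums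
  \<open>2 / 3 ^ Suc k\<close> apart, and the tails can undo at most
  \<open>1 / 3 ^ Suc k\<close>.\<close>

lemma tree_embedding_ternary: "tree_embedding (\<lambda>a::nat \<Rightarrow> bool. \<Sum>n. (if a n then 2 else 0) / 3 ^ Suc n :: real)"
proof -
  define c where "c = (\<lambda>(a::nat \<Rightarrow> bool) n. (if a n then 2 else 0) / 3 ^ Suc n :: real)"
  have geo: "(\<lambda>i. 2 / 3 ^ Suc (i + n) :: real) sums (1 / 3 ^ n)" for n
  proof -
    have "(\<lambda>i. 2 / 3 ^ Suc n * (1/3) ^ i :: real) sums (2 / 3 ^ Suc n * (1 / (1 - 1/3)))"
      by (intro sums_mult geometric_sums) simp
    then show ?thesis by (simp add: power_add power_divide field_simps)
  qed
  have sm: "summable (c a)" for a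
    by (rule summable_comparison_test'[OF sums_summable[OF geo[of 0]], of 0]) (auto simp: c_def)
  have split: "\<bar>(\<Sum>i. c a i) - (\<Sum>i. c b i) - (\<Sum>i<n. c a i - c b i)\<bar> \<le> 1 / 3 ^ n" for a b n
  proof -
    have sd: "summable (\<lambda>i. c a i - c b i)" by (rule summable_diff[OF sm sm])
    have "(\<Sum>i. c a i) - (\<Sum>i. c b i) - (\<Sum>i<n. c a i - c b i) = (\<Sum>i. c a (i + n) - c b (i + n))"
      unfolding suminf_diff[OF sm sm] by (subst suminf_split_initial_segment[OF sd, of n]) simp
    also have "norm \<dots> \<le> (\<Sum>i. 2 / 3 ^ Suc (i + n))"
      by (rule norm_suminf_le[OF _ sums_summable[OF geo]]) (auto simp: c_def)
    also have "\<dots> = 1 / 3 ^ n" using geo sums_unique by metis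
    finally show ?thesis by simp
  qed
  have "tree_embedding (\<lambda>a. \<Sum>n. c a n)"
    unfolding tree_embedding_def
  proof safe
    fix e :: real assume "e > 0"
    then obtain n where n: "(1/3) ^ n < e" using real_arch_pow_inv[of e "1/3"] by auto
    have "dist (\<Sum>i. c a i) (\<Sum>i. c b i) < e" if "\<forall>j<n. a j = b j" for a b
    proof -
      have "(\<Sum>i<n. c a i - c b i) = 0" by (rule sum.neutral) (use that in \<open>auto simp: c_def\<close>)
      then show ?thesis using split[of a b n] n by (simp add: dist_real_def power_divide)
    qed
    then show "\<exists>n. \<forall>a b. (\<forall>j<n. a j = b j) \<longrightarrow> dist (\<Sum>i. c a i) (\<Sum>i. c b i) < e" by blast
  next
    fix k
    have "1 / 3 ^ Suc k \<le> dist (\<Sum>i. c a i) (\<Sum>i. c b i)" if "\<forall>j<k. a j = b j" "a k \<noteq> b k" for a b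
    proof -
      have "(\<Sum>i<k. c a i - c b i) = 0" by (rule sum.neutral) (use that in \<open>auto simp: c_def\<close>)
      then have "\<bar>\<Sum>i<Suc k. c a i - c b i\<bar> = 2 / 3 ^ Suc k" using that(2) by (auto simp: c_def)
      then show ?thesis using split[of a b "Suc k"] unfolding dist_real_def by linarith
    qed
    then show "\<exists>d>0. \<forall>a b. (\<forall>j<k. a j = b j) \<and> a k \<noteq> b k \<longrightarrow> d \<le> dist (\<Sum>i. c a i) (\<Sum>i. c b i)"
      by (intro exI[of _ "1 / 3 ^ Suc k"]) auto
  qed
  then show ?thesis by (simp add: c_def)
qed

lemma is_cantor_set_range:
  assumes "tree_embedding f"
  shows "is_cantor_set (range f)"
  unfolding is_cantor_set_def cantor_ternary_def
  by (rule tree_embedding_homeomorphic[OF assms tree_embedding_ternary])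

subsection \<open>The covering set\<close>

lemma cpoly_continuous: "p \<in> cpoly \<Longrightarrow> continuous_on UNIV (p :: complex^'n::finite \<Rightarrow> complex)"
  by (induction rule: cpoly.induct) (auto intro!: continuous_intros)

lemma closed_phull: "closed (phull (X :: (complex^'n::finite) set))"
proof -
  have "phull X = (\<Inter>p\<in>cpoly. {z. norm (p z) \<le> (SUP x\<in>X. norm (p x))})" by (auto simp: phull_def)
  also have "closed \<dots>"
    by (intro closed_INT ballI closed_Collect_le continuous_on_norm cpoly_continuous) auto
  finally show ?thesis .
qed

lemma cpoly_proj: "p \<in> cpoly \<Longrightarrow> (\<lambda>x. p (proj x)) \<in> cpoly"
proof (induction rule: cpoly.induct)
  case (coord i)
  have "(\<lambda>x. proj x $ i) = (\<lambda>x. x $ Some i)" by (simp add: proj_def)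
  then show ?case by (simp add: cpoly.coord)
qed (simp_all add: cpoly.intros)

lemma proj_phull:
  fixes Y :: "(complex^'n::finite) set"
  assumes "bounded Y" "X \<noteq> {}" "proj ` X \<subseteq> Y" "v \<in> phull X"
  shows "proj v \<in> phull Y"
proof (rule phullI[OF assms(1)])
  fix p :: "complex^'n \<Rightarrow> complex" and C
  assume p: "p \<in> cpoly" and C: "\<And>y. y \<in> Y \<Longrightarrow> norm (p y) \<le> C"
  show "norm (p (proj v)) \<le> C"
    by (rule phullD[OF assms(4,2) cpoly_proj[OF p]]) (rule C, use assms(3) in blast)
qed

lemma closed_proj_vimage: "closed Y \<Longrightarrow> closed (proj -` (Y :: (complex^'n::finite) set))"
  by (rule closed_vimage) (auto simp: proj_def intro!: continuous_intros)

lemma tpoly_sum: "(\<lambda>x::'n::finite pt. \<Sum>j<n. c j * snd x j) \<in> tpoly n"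
proof (induction n)
  case 0
  show ?case using tpoly.const[of 0] by simp
next
  case (Suc n)
  have "(\<lambda>x::'n pt. \<Sum>j<n. c j * snd x j) \<in> tpoly (Suc n)" by (rule tpoly_mono[OF Suc]) simp
  moreover have "(\<lambda>x::'n pt. c n * snd x n) \<in> tpoly (Suc n)"
    by (rule tpoly.mult[OF tpoly.const tpoly.tvar]) simp
  ultimately show ?case using tpoly.add by force
qed

context sqrt_tower
begin

definition base :: "'n pt set" where "base = {x \<in> ltow. fst x \<in> Y}"

definition cover :: "(complex^('n option)) set" where "cover = W ` base"

text \<open>A right inverse of \<open>W\<close> on \<open>cover\<close>. It turns the roots into
  functions on \<open>cover\<close>, to which \<open>hat\<close> applies.\<close>

definition V :: "complex^('n option) \<Rightarrow> 'n pt" where "V = inv_into base W"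

lemma V: "x \<in> cover \<Longrightarrow> V x \<in> ltow" "x \<in> cover \<Longrightarrow> W (V x) = x"
proof -
  assume "x \<in> cover"
  then have "x \<in> W ` base" by (simp add: cover_def)
  then show "V x \<in> ltow" "W (V x) = x"
    unfolding V_def using inv_into_into[of x W base] f_inv_into_f[of x W base] by (auto simp: base_def)
qed

lemma cover_bounded: "bounded cover"
  by (rule bounded_subset[OF bounded_W]) (auto simp: cover_def base_def)

lemma proj_cover: "proj ` cover = Y"
proof -
  have "y \<in> proj ` cover" if "y \<in> Y" for y
  proof -
    have "(y, branch y (\<lambda>_. True)) \<in> base"
      using branch_ltow subset_phull[OF Y_bounded] that by (auto simp: base_def)
    then have "proj (W (y, branch y (\<lambda>_. True))) \<in> proj ` cover" unfolding cover_def by (intro imageI)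
    then show ?thesis by simp
  qed
  then show ?thesis by (auto simp: cover_def base_def)
qed

lemma cover_ne: "cover \<noteq> {}"
  using proj_cover Y_ne by blast

lemma ucl_V:
  assumes "f \<in> ucl wpoly ltow"
  shows "(\<lambda>x. f (V x)) \<in> PX cover"
  unfolding PX_def
proof safe
  fix e :: real assume "e > 0"
  from uclD[OF assms this] obtain p where "p \<in> wpoly" and p: "\<And>x. x \<in> ltow \<Longrightarrow> norm (f x - p x) < e" by blast
  then obtain q where q: "q \<in> cpoly" "p = (\<lambda>x. q (W x))" unfolding wpoly_def by blast
  have "norm (f (V x) - q x) < e" if "x \<in> cover" for x
    using p[OF V(1)[OF that]] V(2)[OF that] by (simp add: q(2))
  with q(1) show "\<exists>q\<in>cpoly. \<forall>x\<in>cover. norm (f (V x) - q x) < e" by blast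
qed

lemma W_phull: "x \<in> ltow \<Longrightarrow> W x \<in> phull cover"
proof (rule phullI[OF cover_bounded])
  fix p C assume x: "x \<in> ltow" and p: "p \<in> cpoly" and C: "\<And>y. y \<in> cover \<Longrightarrow> norm (p y) \<le> C"
  have "(\<lambda>x. p (W x)) \<in> wpoly" unfolding wpoly_def using p by (rule imageI)
  then show "norm (p (W x)) \<le> C"
    by (rule ltow_max_modulus[OF _ _ x]) (rule C, simp add: cover_def base_def)
qed

text \<open>A point of the hull acts as a multiplicative functional. Its values \<open>tau k\<close>
  on the roots satisfy the equations of the tower, so \<open>(proj v, tau)\<close> lies in the
  limit, and continuity of the functional forces the last coordinate of \<open>v\<close> to be
  \<open>wsum tau\<close>.\<close>

lemma phull_W:
  assumes v: "v \<in> phull cover"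
  shows "\<exists>x\<in>ltow. v = W x"
proof -
  interpret hull_point cover v by unfold_locales (use cover_bounded cover_ne v in auto)
  define tau where "tau = (\<lambda>k. hat cover (\<lambda>x. snd (V x) k) v)"
  let ?y = "(proj v, tau)"
  have PXV: "(\<lambda>x. p (V x)) \<in> PX cover" if "p \<in> tpoly k" for p k
    by (rule ucl_V[OF tpoly_ucl_wpoly[OF tvar_ucl_wpoly that]])
  have hat_tpoly: "hat cover (\<lambda>x. p (V x)) v = p ?y" if "p \<in> tpoly k" for p k
    using that
  proof induction
    case (const c)
    show ?case by (rule hat_cpoly[OF cpoly.const])
  next
    case (zvar i)
    have "hat cover (\<lambda>x. fst (V x) $ i) v = hat cover (\<lambda>x. x $ Some i) v"
      by (rule hat_cong) (metis V(2) W_Some)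
    also have "\<dots> = v $ Some i" by (rule hat_cpoly[OF cpoly.coord])
    finally show ?case by (simp add: proj_def)
  next
    case (tvar j)
    show ?case by (simp add: tau_def)
  next
    case (add p q)
    then show ?case using hat_add[OF PXV PXV] by simp
  next
    case (mult p q)
    then show ?case using hat_mult[OF PXV PXV] by simp
  qed
  have "?y \<in> tow k" for k
  proof (induction k)
    case 0
    show ?case using proj_phull[OF Y_bounded cover_ne _ v] proj_cover by simp
  next
    case (Suc k)
    have t: "(\<lambda>x. snd x k) \<in> tpoly (Suc k)" by (rule tpoly.tvar) simp
    have "tau k * tau k = hat cover (\<lambda>x. snd (V x) k * snd (V x) k) v"
      unfolding tau_def by (rule hat_mult[OF PXV[OF t] PXV[OF t], symmetric])
    also have "\<dots> = hat cover (\<lambda>x. ev (rexp k) (V x)) v"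
    proof (rule hat_cong)
      fix x assume "x \<in> cover"
      then have "V x \<in> tow (Suc k)" using V(1) ltow_tow by blast
      then show "snd (V x) k * snd (V x) k = ev (rexp k) (V x)" by (simp add: tow_Suc power2_eq_square)
    qed
    also have "\<dots> = ev (rexp k) ?y" by (rule hat_tpoly[OF rexp_tpoly])
    finally show ?case using Suc by (simp add: tow_Suc power2_eq_square)
  qed
  then have y: "?y \<in> ltow" by (simp add: ltow_def)
  \<comment> \<open>The functional is applied to \<open>w\<close> minus the first \<open>n\<close>
    terms of its series, which is at most \<open>8/7 * cf n\<close> on \<open>cover\<close>; the
    second \<open>8/7 * cf n\<close> is the tail of \<open>wsum tau\<close>.\<close>
  have "norm (v $ None - wsum tau) \<le> 16/7 * cf n" for n
  proof -
    let ?p = "\<lambda>x::'n pt. \<Sum>j<n. (- of_real (wgt j)) * snd x j"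
    have p: "?p \<in> tpoly n" by (rule tpoly_sum)
    have f: "(\<lambda>x. x $ None) \<in> PX cover" by (rule cpoly_PX[OF cpoly.coord])
    have "norm (hat cover (\<lambda>x. x $ None + ?p (V x)) v) \<le> 8/7 * cf n"
    proof (rule hat_le)
      show "(\<lambda>x. x $ None + ?p (V x)) \<in> PX cover"
        using f PXV[OF p] unfolding PX_eq_ucl by (rule add_ucl)
      fix x assume x: "x \<in> cover"
      have "x $ None = wsum (snd (V x))" using W_None[of "V x"] V(2)[OF x] by simp
      then show "norm (x $ None + ?p (V x)) \<le> 8/7 * cf n"
        using wsum_tail[OF V(1)[OF x], of n] by (simp add: sum_negf)
    qed
    then have "norm (v $ None + ?p ?y) \<le> 8/7 * cf n"
      unfolding hat_add[OF f PXV[OF p]] hat_tpoly[OF p] hat_cpoly[OF cpoly.coord] .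
    then have "norm (v $ None - (\<Sum>j<n. of_real (wgt j) * tau j)) \<le> 8/7 * cf n" by (simp add: sum_negf)
    moreover have "norm (wsum tau - (\<Sum>j<n. of_real (wgt j) * tau j)) \<le> 8/7 * cf n"
      using wsum_tail[OF y, of n] by simp
    ultimately show ?thesis
      using norm_triangle_ineq4[of "v $ None - (\<Sum>j<n. of_real (wgt j) * tau j)" "wsum tau - (\<Sum>j<n. of_real (wgt j) * tau j)"] by simp
  qed
  moreover have "(\<lambda>n. 16/7 * cf n) \<longlonglongrightarrow> 0"
    using tendsto_mult_right_zero[OF summable_LIMSEQ_zero[OF summable_cf]] .
  ultimately have "norm (v $ None - wsum tau) \<le> 0"
    by (intro LIMSEQ_le_const[where X = "\<lambda>n. 16/7 * cf n"]) auto
  then have None: "v $ None = wsum tau" by simp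
  have "v $ i = W ?y $ i" for i
    by (cases i) (simp_all add: None proj_def)
  then have "v = W ?y" by (simp add: vec_eq_iff)
  with y show ?thesis by blast
qed

lemma phull_cover: "phull cover = W ` ltow"
  using W_phull phull_W by blast

text \<open>The hull is closed, so cutting it down to the part over \<open>Y\<close> yields
  compactness of \<open>cover\<close> when \<open>Y\<close> is closed.\<close>

lemma cover_eq: "cover = {v \<in> phull cover. proj v \<in> Y}"
  by (auto simp: phull_cover) (auto simp: cover_def base_def)

lemma compact_cover: "closed Y \<Longrightarrow> compact cover"
proof -
  assume "closed Y"
  then have "closed (phull cover \<inter> proj -` Y)" by (intro closed_Int closed_phull closed_proj_vimage)
  moreover have "phull cover \<inter> proj -` Y = cover" using cover_eq by blast
  ultimately show ?thesis using cover_bounded by (simp add: compact_eq_bounded_closed)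
qed

lemma proj_phull_cover: "proj ` (phull cover - cover) = phull Y - Y"
proof
  show "proj ` (phull cover - cover) \<subseteq> phull Y - Y"
  proof (rule image_subsetI)
    fix v assume v: "v \<in> phull cover - cover"
    then obtain x where x: "x \<in> ltow" "v = W x" using phull_W by blast
    then show "proj v \<in> phull Y - Y" using v ltow_fst[OF x(1)] by (auto simp: cover_def base_def)
  qed
  show "phull Y - Y \<subseteq> proj ` (phull cover - cover)"
  proof
    fix z assume z: "z \<in> phull Y - Y"
    let ?v = "W (z, branch z (\<lambda>_. True))"
    have "?v \<in> phull cover" using W_phull branch_ltow z by blast
    moreover have "?v \<notin> cover" using z proj_cover proj_W[of "(z, branch z (\<lambda>_. True))"] by force
    ultimately have "proj ?v \<in> proj ` (phull cover - cover)" by blast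
    then show "z \<in> proj ` (phull cover - cover)" by simp
  qed
qed

lemma dense_invertibles_cover: "dense_invertibles cover"
  unfolding dense_invertibles_def
proof (intro ballI allI impI)
  fix f :: "complex^('n option) \<Rightarrow> complex" and e :: real
  assume f: "f \<in> PX cover" and e: "e > 0"
  then have e3: "e/3 > 0" by simp
  obtain p where p: "p \<in> cpoly" "\<And>x. x \<in> cover \<Longrightarrow> norm (f x - p x) < e/3"
    by (rule uclD[OF f[unfolded PX_eq_ucl] e3]) blast
  have pW: "(\<lambda>x. p (W x)) \<in> wpoly" unfolding wpoly_def using p(1) by (rule imageI)
  obtain q where q: "q \<in> wpoly" "invertible_in wpoly ltow q" "\<And>x. x \<in> ltow \<Longrightarrow> norm (p (W x) - q x) < e/3"
    by (rule dense_inv_approx[OF fun_algebra_wpoly dense_inv_wpoly subsetD[OF ucl_subset_gens pW] e3]) blast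
  obtain g where g: "g \<in> cpoly" "q = (\<lambda>x. g (W x))" using q(1) unfolding wpoly_def by blast
  obtain h where h: "h \<in> ucl wpoly ltow" "\<forall>x\<in>ltow. q x * h x = 1" using q(2) unfolding invertible_in_def by blast
  have "\<forall>x\<in>cover. g x * h (V x) = 1" using h(2) V g(2) by force
  then have invV: "\<exists>h\<in>PX cover. \<forall>x\<in>cover. g x * h x = 1" by (rule bexI[OF _ ucl_V[OF h(1)]])
  have "norm (f x - g x) \<le> 2 * e/3" if x: "x \<in> cover" for x
    using p(2)[OF x] q(3)[OF V(1)[OF x]] V(2)[OF x] norm_triangle_ineq[of "f x - p x" "p x - g x"]
    by (simp add: g(2))
  then have "supn cover (\<lambda>x. f x - g x) \<le> 2 * e/3"
    unfolding supn_def by (rule cSUP_least[OF cover_ne])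
  then have "supn cover (\<lambda>x. f x - g x) < e" using e by simp
  with invV have "(\<exists>h\<in>PX cover. \<forall>x\<in>cover. g x * h x = 1) \<and> supn cover (\<lambda>x. f x - g x) < e" by (rule conjI)
  moreover have "g \<in> PX cover" using g(1) ucl_subset_gens unfolding PX_eq_ucl by blast
  ultimately show "\<exists>g\<in>PX cover. (\<exists>h\<in>PX cover. \<forall>x\<in>cover. g x * h x = 1) \<and> supn cover (\<lambda>x. f x - g x) < e"
    by (rule bexI)
qed

text \<open>The tower provides a root whose square is close to \<open>p\<close>, but that root is
  only a limit of polynomials in the encoded coordinates. It is replaced by such a polynomial, and
  \<open>C\<close> bounds the error made on squaring.\<close>

lemma dense_squares_cover:
  assumes p: "p \<in> cpoly" and e: "e > 0"
  shows "\<exists>g\<in>cpoly. \<forall>x\<in>cover. norm (p x - (g x)\<^sup>2) \<le> e"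
proof -
  have e2: "e/2 > 0" using e by simp
  have pW: "(\<lambda>x. p (W x)) \<in> wpoly" unfolding wpoly_def using p by (rule imageI)
  obtain k where k: "\<And>x. x \<in> ltow \<Longrightarrow> norm (p (W x) - (snd x k)\<^sup>2) < e/2"
    by (rule dense_squares_wpoly[OF subsetD[OF ucl_subset_gens pW] e2]) blast
  define C where "C = 2 * ub k + 1"
  define d where "d = min 1 (e/2 / C)"
  have ub: "C > 0" using ub_lb(3)[of k] by (simp add: C_def)
  have d: "d > 0" "d \<le> 1" using e ub by (auto simp: d_def)
  have "d * C \<le> e/2 / C * C"
    by (rule mult_right_mono) (use ub in \<open>auto simp: d_def\<close>)
  then have de: "d * (2 * ub k + 1) \<le> e/2" using ub unfolding C_def[symmetric] by simp
  obtain q where q: "q \<in> wpoly" "\<And>x. x \<in> ltow \<Longrightarrow> norm (snd x k - q x) < d"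
    by (rule uclD[OF tvar_ucl_wpoly d(1)]) blast
  obtain g where g: "g \<in> cpoly" "q = (\<lambda>x. g (W x))" using q(1) unfolding wpoly_def by blast
  have "norm (p x - (g x)\<^sup>2) \<le> e" if x: "x \<in> cover" for x
  proof -
    let ?t = "snd (V x) k"
    have t: "norm ?t \<le> ub k" by (rule ub_lb(5)) (use V(1)[OF x] ltow_tow in blast)
    have tq: "norm (?t - g x) \<le> d" using q(2)[OF V(1)[OF x]] V(2)[OF x] by (simp add: g(2))
    have "norm (?t * ?t - g x * g x) \<le> e/2"
      by (rule order_trans[OF prod_approx[OF tq tq t t d(2)] de])
    moreover have "norm (p x - ?t * ?t) < e/2"
      using k[OF V(1)[OF x]] V(2)[OF x] by (simp add: power2_eq_square)
    ultimately show ?thesis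
      using norm_triangle_ineq[of "p x - ?t * ?t" "?t * ?t - g x * g x"] by (simp add: power2_eq_square)
  qed
  with g(1) show ?thesis by blast
qed

lemma dist_W: "dist (W (z, s)) (W (z, t)) = norm (wsum s - wsum t)"
proof -
  have "W (z, s) - W (z, t) = axis None (wsum s - wsum t)"
    by (auto simp: vec_eq_iff axis_def W_def split: option.splits)
  then show ?thesis 
    by (simp add: dist_norm norm_vec_def L2_set_def axis_def if_distrib[of norm] if_distrib[of "\<lambda>x. x\<^sup>2"] cong: if_cong)
qed

text \<open>The branches exhaust the fiber, and \<open>branch_close\<close> and
  \<open>branch_separated\<close> supply the two clauses of \<open>tree_embedding\<close>.\<close>

lemma fiber_cantor:
  assumes z: "z \<in> phull Y"
  shows "is_cantor_set {x \<in> phull cover. proj x = z}"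
proof -
  have "{x \<in> phull cover. proj x = z} = range (\<lambda>a. W (z, branch z a))"
  proof safe
    fix x assume "x \<in> phull cover" "z = proj x"
    then obtain y where y: "y \<in> ltow" "x = W y" "fst y = z" by (auto simp: phull_cover)
    obtain a where "y = (fst y, branch (fst y) a)" by (rule ltow_branch[OF y(1)])
    then have "x = W (z, branch z a)" using y by metis
    then show "x \<in> range (\<lambda>a. W (proj x, branch (proj x) a))"
      unfolding \<open>z = proj x\<close> by (rule image_eqI[of _ "\<lambda>a. W (proj x, branch (proj x) a)" a]) (rule UNIV_I)
  qed (auto intro: W_phull branch_ltow[OF z])
  moreover have "tree_embedding (\<lambda>a. W (z, branch z a))"
    unfolding tree_embedding_def dist_W
  proof safe
    fix e :: real assume "e > 0"
    have "(\<lambda>n. 16/7 * cf n) \<longlonglongrightarrow> 0"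
      using tendsto_mult_right_zero[OF summable_LIMSEQ_zero[OF summable_cf]] .
    from order_tendstoD(2)[OF this \<open>e > 0\<close>] obtain n where n: "16/7 * cf n < e"
      by (auto simp: eventually_sequentially)
    have "norm (wsum (branch z a) - wsum (branch z b)) < e" if "\<forall>j<n. a j = b j" for a b
      using branch_close[OF z, of n a b] that n by fastforce
    then show "\<exists>n. \<forall>a b. (\<forall>j<n. a j = b j) \<longrightarrow> norm (wsum (branch z a) - wsum (branch z b)) < e" by blast
  next
    fix k
    have "wgt k * lb k > 0" using wgt_pos ub_lb(1) by simp
    moreover have "wgt k * lb k \<le> norm (wsum (branch z a) - wsum (branch z b))"
      if "\<forall>j<k. a j = b j" "a k \<noteq> b k" for a b
      by (rule branch_separated[OF z]) (use that in auto)
    ultimately show "\<exists>d>0. \<forall>a b. (\<forall>j<k. a j = b j) \<and> a k \<noteq> b k \<longrightarrow> d \<le> norm (wsum (branch z a) - wsum (branch z b))"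
      by blast
  qed
  ultimately show ?thesis using is_cantor_set_range by metis
qed

end

theorem theorem7p6:
  fixes Y :: "(complex^'n::finite) set"
  assumes "compact Y" and "phull Y - Y \<noteq> {}" and "dense_invertibles Y"
  shows "\<exists>X :: (complex^('n option)) set.
           compact X \<and>
           proj ` X = Y \<and>
           proj ` (phull X - X) = phull Y - Y \<and>
           dense_invertibles X \<and>
           (\<forall>z\<in>phull X. one_point_part X z) \<and>
           (\<forall>z\<in>phull X. \<forall>\<psi>. bounded_point_derivation X z \<psi> \<longrightarrow> (\<forall>f\<in>PX X. \<psi> f = 0)) \<and>
           (\<forall>z\<in>phull Y. is_cantor_set {x\<in>phull X. proj x = z})"
proof -
  have "Y \<noteq> {}"
  proof
    assume "Y = {}"
    then obtain z where z: "z \<in> phull Y" using assms(2) by blast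
    \<comment> \<open>Over the empty set the supremum is the fixed real \<open>Sup {}\<close>. A
      constant polynomial of larger modulus violates the hull condition at every point, so the hull
      would be empty too.\<close>
    have "norm (of_real (\<bar>Sup {}\<bar> + 1) :: complex) \<le> (SUP x\<in>Y. norm (of_real (\<bar>Sup {}\<bar> + 1) :: complex))"
      using z cpoly.const unfolding phull_def by fast
    then show False using \<open>Y = {}\<close> by (simp del: of_real_add)
  qed
  moreover have "bounded Y" using assms(1) by (rule compact_imp_bounded)
  ultimately interpret sqrt_tower Y
    by unfold_locales (use dense_inv_phull assms(3) in auto)
  have "one_point_part cover z" if "z \<in> phull cover" for z
    by (rule one_point_partI[OF cover_bounded cover_ne that dense_squares_cover])
  moreover have "\<psi> f = 0" if "z \<in> phull cover" "bounded_point_derivation cover z \<psi>" "f \<in> PX cover" for z \<psi> f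
  proof -
    interpret hull_point cover z by unfold_locales (use cover_bounded cover_ne that in auto)
    show ?thesis by (rule no_bounded_point_derivation[OF dense_squares_cover that(2,3)])
  qed
  ultimately show ?thesis
    using compact_cover[OF compact_imp_closed[OF assms(1)]] proj_cover proj_phull_cover dense_invertibles_cover fiber_cantor
    by (intro exI[of _ cover]) blast
qed

end
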